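(* Let $R$ be a Noetherian local ring of positive prime characteristic $p$. If $S$ is a minimal seed over $R$, then $S$ is a domain.
   Context: All rings are commutative with identity. For a Noetherian local ring $(R,m)$, a big Cohen-Macaulay $R$-algebra is an $R$-algebra $B$ (not necessarily Noetherian or finitely generated) such that some system of parameters of $R$ is a regular sequence on $B$ (a regular sequence $x_1,\ldots,x_d$ on $B$ is required to satisfy $(x_1,\ldots,x_d)B\neq B$). An $R$-algebra $S$ is a seed over $R$ if there is an $R$-algebra homomorphism from $S$ to some big Cohen-Macaulay $R$-algebra. An $R$-algebra $S$ is a minimal seed over $R$ if $S$ is a seed over $R$ and no proper homomorphic image of $S$ (i.e. no $S/J$ with $J$ a nonzero ideal of $S$) is a seed over $R$. *)

theory Defs
  imports "HOL-Algebra.Algebra" "HOL-Library.Extended_Nat"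
begin

text \<open>
  Conventions.  Rings are HOL-Algebra records.  An algebra over the commutative ring \<open>R\<close> is a
  commutative ring \<open>S\<close> together with its structure map \<open>\<phi>\<close>, a ring homomorphism from \<open>R\<close> to \<open>S\<close>;
  this is the library locale \<^locale>\<open>ring_hom_cring\<close>.
\<close>

section \<open>Noetherian local rings and systems of parameters\<close>

locale noetherian_local_ring = cring R + noetherian_ring R for R (structure) +
  assumes unique_maximal: "\<exists>!M. maximalideal M R"

definition max_ideal :: "('r, 'm) ring_scheme \<Rightarrow> 'r set" where
  "max_ideal R = (THE M. maximalideal M R)"

text \<open>The characteristic is the additive order of \<open>1\<close>; \<^const>\<open>group.ord\<close> is \<open>0\<close> for elements of
  infinite order.\<close>

definition ring_char :: "('r, 'm) ring_scheme \<Rightarrow> nat" where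
  "ring_char R = group.ord (add_monoid R) \<one>\<^bsub>R\<^esub>"

definition krull_dim :: "('r, 'm) ring_scheme \<Rightarrow> enat" where
  "krull_dim R = Sup {enat n | n. \<exists>P :: nat \<Rightarrow> 'r set.
     (\<forall>i\<le>n. primeideal (P i) R) \<and> (\<forall>i<n. P i \<subset> P (Suc i))}"

text \<open>A system of parameters of a Noetherian local ring: \<open>dim R\<close> many elements of the maximal ideal
  generating an ideal whose radical is the maximal ideal.\<close>

definition system_of_parameters :: "('r, 'm) ring_scheme \<Rightarrow> 'r list \<Rightarrow> bool" where
  "system_of_parameters R xs \<longleftrightarrow>
     set xs \<subseteq> max_ideal R \<and>
     enat (length xs) = krull_dim R \<and>
     {a \<in> carrier R. \<exists>n::nat. a [^]\<^bsub>R\<^esub> n \<in> Idl\<^bsub>R\<^esub> (set xs)} = max_ideal R"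

section \<open>Big Cohen-Macaulay algebras\<close>

definition regular_sequence :: "('b, 'm) ring_scheme \<Rightarrow> 'b list \<Rightarrow> bool" where
  "regular_sequence B ys \<longleftrightarrow>
     set ys \<subseteq> carrier B \<and>
     (\<forall>k < length ys. \<forall>b \<in> carrier B.
        ys ! k \<otimes>\<^bsub>B\<^esub> b \<in> Idl\<^bsub>B\<^esub> (set (take k ys)) \<longrightarrow> b \<in> Idl\<^bsub>B\<^esub> (set (take k ys))) \<and>
     Idl\<^bsub>B\<^esub> (set ys) \<noteq> carrier B"

definition big_CM_algebra ::
  "('r, 'm) ring_scheme \<Rightarrow> ('b, 'n) ring_scheme \<Rightarrow> ('r \<Rightarrow> 'b) \<Rightarrow> bool" where
  "big_CM_algebra R B \<psi> \<longleftrightarrow>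
     ring_hom_cring R B \<psi> \<and>
     (\<exists>xs. system_of_parameters R xs \<and> regular_sequence B (map \<psi> xs))"

definition algebra_hom ::
  "('r, 'm) ring_scheme \<Rightarrow> ('s, 'n) ring_scheme \<Rightarrow> ('r \<Rightarrow> 's) \<Rightarrow>
   ('b, 'k) ring_scheme \<Rightarrow> ('r \<Rightarrow> 'b) \<Rightarrow> ('s \<Rightarrow> 'b) set" where
  "algebra_hom R S \<phi> B \<psi> = {h \<in> ring_hom S B. \<forall>r \<in> carrier R. h (\<phi> r) = \<psi> r}"

section \<open>Seeds\<close>

text \<open>
  HOL cannot quantify existentially over types, so the type of the elements of the big
  Cohen-Macaulay algebra \<open>B\<close> has to be named.  Its elements are taken to be finite words over the
  disjoint union of the type of \<open>S\<close> and the natural numbers.  This loses nothing: by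
  \<open>seed_if_hom_to_big_CM\<close> below, a homomorphism to a big Cohen-Macaulay algebra over any type
  whatsoever makes \<open>S\<close> a seed (a downward Loewenheim-Skolem argument).
\<close>

definition seed ::
  "('r, 'm) ring_scheme \<Rightarrow> ('s, 'n) ring_scheme \<Rightarrow> ('r \<Rightarrow> 's) \<Rightarrow> bool" where
  "seed R S \<phi> \<longleftrightarrow>
     ring_hom_cring R S \<phi> \<and>
     (\<exists>(B :: ('s + nat) list ring) \<psi> h.
        big_CM_algebra R B \<psi> \<and> h \<in> algebra_hom R S \<phi> B \<psi>)"

definition minimal_seed ::
  "('r, 'm) ring_scheme \<Rightarrow> ('s, 'n) ring_scheme \<Rightarrow> ('r \<Rightarrow> 's) \<Rightarrow> bool" where
  "minimal_seed R S \<phi> \<longleftrightarrow>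
     seed R S \<phi> \<and>
     (\<forall>J. ideal J S \<and> J \<noteq> {\<zero>\<^bsub>S\<^esub>} \<longrightarrow> \<not> seed R (S Quot J) (\<lambda>r. J +>\<^bsub>S\<^esub> \<phi> r))"

section \<open>Independence of the choice of type in the definition of seeds\<close>

lemma closure_embeds_in_words:
  fixes g :: "'s \<Rightarrow> 'b" and F :: "nat \<Rightarrow> 'b \<Rightarrow> 'b \<Rightarrow> 'b"
  assumes g: "\<And>s. g s \<in> Z" and F: "\<And>n a b. a \<in> Z \<Longrightarrow> b \<in> Z \<Longrightarrow> F n a b \<in> Z"
  obtains Y and c :: "'b \<Rightarrow> ('s + nat) list" where
    "Y \<subseteq> Z" "\<And>s. g s \<in> Y" "\<And>n a b. a \<in> Y \<Longrightarrow> b \<in> Y \<Longrightarrow> F n a b \<in> Y" "inj_on c Y"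
proof -
  \<comment> \<open>words are programs in reverse Polish notation for a stack machine\<close>
  define step :: "'s + nat \<Rightarrow> 'b list \<Rightarrow> 'b list" where
    "step = (\<lambda>l st. case l of Inl s \<Rightarrow> g s # st
                     | Inr n \<Rightarrow> (case st of b # a # st' \<Rightarrow> F n a b # st' | _ \<Rightarrow> st))"
  define Q where "Q = (\<lambda>b w. \<forall>st. fold step w st = b # st)"
  define Y where "Y = {b \<in> Z. \<exists>w. Q b w}"
  define c where "c = (\<lambda>b. SOME w. Q b w)"
  have c: "Q b (c b)" if "b \<in> Y" for b
    using that someI_ex[of "Q b"] unfolding Y_def c_def by blast
  show thesis
  proof (rule that)
    show "Y \<subseteq> Z" unfolding Y_def by blast
    show "g s \<in> Y" for s
    proof -
      have "Q (g s) [Inl s]" by (simp add: Q_def step_def)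
      then show ?thesis using g unfolding Y_def by blast
    qed
    show "F n a b \<in> Y" if "a \<in> Y" "b \<in> Y" for n a b
    proof -
      have "Q (F n a b) (c a @ c b @ [Inr n])"
        using c[OF that(1)] c[OF that(2)] by (simp add: Q_def step_def)
      then show ?thesis using that F unfolding Y_def by blast
    qed
    show "inj_on c Y"
    proof (rule inj_onI)
      fix a b assume ab: "a \<in> Y" "b \<in> Y" "c a = c b"
      have "a # [] = b # []" using c[OF ab(1)] c[OF ab(2)] ab(3) unfolding Q_def by metis
      then show "a = b" by simp
    qed
  qed
qed

lemma (in cring) mem_Idl_insert_iff:
  assumes y: "y \<in> carrier R" and A: "A \<subseteq> carrier R" and b: "b \<in> carrier R"
  shows "b \<in> Idl (insert y A) \<longleftrightarrow> (\<exists>c \<in> carrier R. b \<ominus> c \<otimes> y \<in> Idl A)"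
proof
  let ?K = "Idl A <+>\<^bsub>R\<^esub> PIdl y"
  interpret I: ideal "Idl A" R by (rule genideal_ideal[OF A])
  interpret P: ideal "PIdl y" R by (rule cgenideal_ideal[OF y])
  interpret K: ideal ?K R by (rule add_ideals[OF I.ideal_axioms P.ideal_axioms])
  have K: "i \<oplus> c \<in> ?K" if "i \<in> Idl A" "c \<in> PIdl y" for i c
    using that unfolding set_add_def' by blast
  have "y \<in> ?K"
    using K[OF I.zero_closed cgenideal_self[OF y]] y by simp
  moreover have "A \<subseteq> ?K"
  proof
    fix a assume a: "a \<in> A"
    then have "a \<in> Idl A" "a \<in> carrier R" using genideal_self[OF A] A by blast+
    then show "a \<in> ?K" using K[OF _ P.zero_closed, of a] by simp
  qed
  ultimately have sub: "Idl (insert y A) \<subseteq> ?K"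
    by (intro genideal_minimal K.ideal_axioms) auto
  assume "b \<in> Idl (insert y A)"
  then obtain i c where ic: "i \<in> Idl A" "c \<in> carrier R" "b = i \<oplus> c \<otimes> y"
    using sub unfolding set_add_def' cgenideal_def by blast
  then have "b \<ominus> c \<otimes> y = i"
    using y I.Icarr[OF ic(1)] by (simp add: minus_eq a_assoc r_neg)
  then show "\<exists>c \<in> carrier R. b \<ominus> c \<otimes> y \<in> Idl A" using ic by blast
next
  have iA: "insert y A \<subseteq> carrier R" using y A by blast
  interpret J: ideal "Idl (insert y A)" R by (rule genideal_ideal[OF iA])
  have sub: "Idl A \<subseteq> Idl (insert y A)"
    using genideal_self[OF iA] by (intro genideal_minimal J.ideal_axioms) auto
  assume "\<exists>c \<in> carrier R. b \<ominus> c \<otimes> y \<in> Idl A"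
  then obtain c where c: "c \<in> carrier R" "b \<ominus> c \<otimes> y \<in> Idl (insert y A)" using sub by blast
  have "c \<otimes> y \<in> Idl (insert y A)"
    using genideal_self[OF iA] c(1) by (intro J.I_l_closed) auto
  then have "(b \<ominus> c \<otimes> y) \<oplus> c \<otimes> y \<in> Idl (insert y A)" by (rule J.a_closed[OF c(2)])
  moreover have "(b \<ominus> c \<otimes> y) \<oplus> c \<otimes> y = b"
    using b c(1) y by (simp add: minus_eq a_assoc l_neg)
  ultimately show "b \<in> Idl (insert y A)" by simp
qed

lemma regular_sequence_descends:
  fixes C (structure) and B (structure)
  assumes "ring_hom_cring C B e" and inj: "inj_on e (carrier C)"
    and ys: "set ys \<subseteq> carrier C"
    and reg: "regular_sequence B (map e ys)"
    and coeff: "\<And>k b. k < length ys \<Longrightarrow> b \<in> carrier C \<Longrightarrow>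
       e b \<in> Idl\<^bsub>B\<^esub> (set (take (Suc k) (map e ys))) \<Longrightarrow>
       \<exists>c \<in> carrier C. e b \<ominus>\<^bsub>B\<^esub> e c \<otimes>\<^bsub>B\<^esub> e (ys ! k) \<in> Idl\<^bsub>B\<^esub> (set (take k (map e ys)))"
  shows "regular_sequence C ys"
proof -
  interpret ring_hom_cring C B e by fact
  let ?I = "\<lambda>k. Idl\<^bsub>B\<^esub> (set (take k (map e ys)))" and ?J = "\<lambda>k. Idl\<^bsub>C\<^esub> (set (take k ys))"
  have ysk: "ys ! k \<in> carrier C" if "k < length ys" for k using that ys by auto
  have tk: "set (take k ys) \<subseteq> carrier C" for k
    using ys set_take_subset by fast
  then have tB: "set (take k (map e ys)) \<subseteq> carrier B" for k
    by (simp add: take_map) blast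
  have ins: "set (take (Suc k) zs) = insert (zs ! k) (set (take k zs))"
    if "k < length zs" for k and zs :: "'z list"
    using that by (simp add: take_Suc_conv_app_nth)
  have Idl0: "Idl\<^bsub>C\<^esub> {} = {\<zero>\<^bsub>C\<^esub>}" "Idl\<^bsub>B\<^esub> {} = {\<zero>\<^bsub>B\<^esub>}"
  proof -
    show "Idl\<^bsub>C\<^esub> {} = {\<zero>\<^bsub>C\<^esub>}"
      using R.genideal_minimal[OF R.zeroideal, of "{}"]
        additive_subgroup.zero_closed[OF ideal.axioms(1)[OF R.genideal_ideal[of "{}"]]] by auto
    show "Idl\<^bsub>B\<^esub> {} = {\<zero>\<^bsub>B\<^esub>}"
      using S.genideal_minimal[OF S.zeroideal, of "{}"]
        additive_subgroup.zero_closed[OF ideal.axioms(1)[OF S.genideal_ideal[of "{}"]]] by auto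
  qed
  have iff: "e b \<in> ?I k \<longleftrightarrow> b \<in> ?J k" if "k \<le> length ys" "b \<in> carrier C" for k b
    using that
  proof (induction k arbitrary: b)
    case 0
    then show ?case using inj_onD[OF inj, of b "\<zero>\<^bsub>C\<^esub>"] by (auto simp: Idl0)
  next
    case (Suc k)
    then have k: "k < length ys" by simp
    have e: "e b \<ominus>\<^bsub>B\<^esub> e c \<otimes>\<^bsub>B\<^esub> e (ys ! k) = e (b \<ominus>\<^bsub>C\<^esub> c \<otimes>\<^bsub>C\<^esub> ys ! k)"
      if "c \<in> carrier C" for c
      using that Suc.prems ysk[OF k] by (simp add: a_minus_def)
    have cl: "b \<ominus>\<^bsub>C\<^esub> c \<otimes>\<^bsub>C\<^esub> ys ! k \<in> carrier C" if "c \<in> carrier C" for c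
      using that Suc.prems ysk[OF k] by simp
    have B: "e b \<in> ?I (Suc k) \<longleftrightarrow>
        (\<exists>c \<in> carrier B. e b \<ominus>\<^bsub>B\<^esub> c \<otimes>\<^bsub>B\<^esub> e (ys ! k) \<in> ?I k)"
      using S.mem_Idl_insert_iff[of "e (ys ! k)" "set (take k (map e ys))" "e b"]
        ins[of k "map e ys"] k tB ysk[OF k] Suc.prems by simp
    have C: "b \<in> ?J (Suc k) \<longleftrightarrow> (\<exists>c \<in> carrier C. b \<ominus>\<^bsub>C\<^esub> c \<otimes>\<^bsub>C\<^esub> ys ! k \<in> ?J k)"
      using R.mem_Idl_insert_iff[of "ys ! k" "set (take k ys)" b]
        ins[of k ys] k tk ysk[OF k] Suc.prems by simp
    have "e b \<in> ?I (Suc k) \<longleftrightarrow> (\<exists>c \<in> carrier C. e b \<ominus>\<^bsub>B\<^esub> e c \<otimes>\<^bsub>B\<^esub> e (ys ! k) \<in> ?I k)"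
      using coeff[OF k Suc.prems(2)] B hom_closed by blast
    also have "\<dots> \<longleftrightarrow> (\<exists>c \<in> carrier C. b \<ominus>\<^bsub>C\<^esub> c \<otimes>\<^bsub>C\<^esub> ys ! k \<in> ?J k)"
      using e cl Suc.IH k by (metis less_imp_le)
    finally show ?case using C by simp
  qed
  show ?thesis
    unfolding regular_sequence_def
  proof (intro conjI allI impI ballI)
    show "set ys \<subseteq> carrier C" by fact
  next
    fix k b assume k: "k < length ys" and b: "b \<in> carrier C" and m: "ys ! k \<otimes>\<^bsub>C\<^esub> b \<in> ?J k"
    have "e (ys ! k \<otimes>\<^bsub>C\<^esub> b) \<in> ?I k" using iff[of k "ys ! k \<otimes>\<^bsub>C\<^esub> b"] k b m ysk[OF k] by simp
    then have "map e ys ! k \<otimes>\<^bsub>B\<^esub> e b \<in> ?I k" using k b ysk[OF k] by simp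
    then have "e b \<in> ?I k"
      using reg k hom_closed[OF b] unfolding regular_sequence_def by simp
    then show "b \<in> ?J k" using iff[of k b] k b by simp
  next
    have "set (map e ys) \<subseteq> carrier B" using ys by auto
    then interpret I: ideal "Idl\<^bsub>B\<^esub> (set (map e ys))" B by (rule S.genideal_ideal)
    have "\<one>\<^bsub>B\<^esub> \<notin> Idl\<^bsub>B\<^esub> (set (map e ys))"
      using reg I.one_imp_carrier unfolding regular_sequence_def by blast
    then have "\<one>\<^bsub>C\<^esub> \<notin> Idl\<^bsub>C\<^esub> (set ys)" using iff[of "length ys" "\<one>\<^bsub>C\<^esub>"] by simp
    then show "Idl\<^bsub>C\<^esub> (set ys) \<noteq> carrier C" using R.one_closed by blast
  qed
qed

lemma seed_if_hom_to_big_CM: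
  fixes R :: "('r, 'm) ring_scheme" and S :: "('s, 'n) ring_scheme" and B :: "('b, 'k) ring_scheme"
  assumes S: "ring_hom_cring R S \<phi>" and B: "big_CM_algebra R B \<psi>"
    and h: "h \<in> algebra_hom R S \<phi> B \<psi>"
  shows "seed R S \<phi>"
proof -
  interpret RS: ring_hom_cring R S \<phi> by (rule S)
  have "ring_hom_cring R B \<psi>" using B unfolding big_CM_algebra_def by (rule conjunct1)
  then interpret RB: ring_hom_cring R B \<psi> .
  obtain xs where xs: "system_of_parameters R xs" and reg: "regular_sequence B (map \<psi> xs)"
    using B unfolding big_CM_algebra_def by blast
  have hh: "h \<in> ring_hom S B" and h\<phi>: "\<And>r. r \<in> carrier R \<Longrightarrow> h (\<phi> r) = \<psi> r"
    using h unfolding algebra_hom_def by auto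
  have "set xs \<subseteq> carrier R"
    using xs unfolding system_of_parameters_def by blast
  then have xsR: "\<And>k. k < length xs \<Longrightarrow> xs ! k \<in> carrier R" by auto
  let ?y = "map \<psi> xs"
  let ?P = "\<lambda>k b c. c \<in> carrier B \<and> b \<ominus>\<^bsub>B\<^esub> c \<otimes>\<^bsub>B\<^esub> ?y ! k \<in> Idl\<^bsub>B\<^esub> (set (take k ?y))"
  define g where "g = (\<lambda>s. if s \<in> carrier S then h s else \<zero>\<^bsub>B\<^esub>)"
  define co where "co = (\<lambda>k b. if \<exists>c. ?P k b c then SOME c. ?P k b c else \<zero>\<^bsub>B\<^esub>)"
  define F where "F = (\<lambda>n a b. if n = 0 then a \<oplus>\<^bsub>B\<^esub> b else if n = 1 then a \<otimes>\<^bsub>B\<^esub> b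
     else if n = 2 then \<ominus>\<^bsub>B\<^esub> a else co (n - 3) a)"
  have co: "?P k b (co k b)" if "\<exists>c. ?P k b c" for k b
    unfolding co_def if_P[OF that] by (rule someI_ex[OF that])
  have co_carr: "co k b \<in> carrier B" for k b
    using co[of b k] by (cases "\<exists>c. ?P k b c") (auto simp: co_def)
  have gX: "g s \<in> carrier B" for s using ring_hom_closed[OF hh] by (simp add: g_def)
  have FX: "F n a b \<in> carrier B" if "a \<in> carrier B" "b \<in> carrier B" for n a b
    using that co_carr by (simp add: F_def)
  obtain Y and c :: "'b \<Rightarrow> ('s + nat) list" where
    Y: "Y \<subseteq> carrier B" and gY: "\<And>s. g s \<in> Y"
    and FY: "\<And>n a b. a \<in> Y \<Longrightarrow> b \<in> Y \<Longrightarrow> F n a b \<in> Y" and c: "inj_on c Y"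
    using closure_embeds_in_words[where Z = "carrier B" and g = g and F = F] gX FX by metis
  have hY: "h s \<in> Y" if "s \<in> carrier S" for s using gY[of s] that by (simp add: g_def)
  have coY: "co k b \<in> Y" if "b \<in> Y" for k b using FY[of b b "k + 3"] that by (simp add: F_def)
  have "subring Y B"
  proof (rule RB.S.subringI[OF Y])
    show "\<one>\<^bsub>B\<^esub> \<in> Y" using hY[of "\<one>\<^bsub>S\<^esub>"] ring_hom_one[OF hh] by simp
    show "\<ominus>\<^bsub>B\<^esub> a \<in> Y" if "a \<in> Y" for a using FY[of a a 2] that by (simp add: F_def)
    show "a \<otimes>\<^bsub>B\<^esub> b \<in> Y" if "a \<in> Y" "b \<in> Y" for a b using FY[of a b 1] that by (simp add: F_def)
    show "a \<oplus>\<^bsub>B\<^esub> b \<in> Y" if "a \<in> Y" "b \<in> Y" for a b using FY[of a b 0] that by (simp add: F_def)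
  qed
  define B' where "B' = B\<lparr>carrier := Y\<rparr>"
  have B'cring: "cring B'"
    using RB.S.subcringI'[OF \<open>subring Y B\<close>] RB.S.subcring_iff[OF Y] unfolding B'_def by blast
  interpret B': cring B' by (rule B'cring)
  define C where "C = image_ring c B'"
  have cB': "inj_on c (carrier B')" using c by (simp add: B'_def)
  have iso: "c \<in> ring_iso B' C"
    unfolding C_def by (rule inj_imp_image_ring_iso[OF cB'])
  have "cring (C\<lparr>carrier := carrier C, zero := c \<zero>\<^bsub>B'\<^esub>\<rparr>)"
    using B'.ring_iso_imp_img_cring[OF iso] by simp
  then have Ccring: "cring C"
    unfolding C_def by (simp add: image_ring_def image_group_def monoid.defs)
  interpret C: cring C by (rule Ccring)
  define e where "e = inv_into (carrier B') c"
  have "e \<in> ring_iso C B'"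
    unfolding e_def by (rule ring_iso_set_sym[OF B'.ring_axioms iso])
  then have eY: "e \<in> ring_hom C B'" and ebij: "bij_betw e (carrier C) Y"
    by (auto simp: ring_iso_def B'_def)
  then have eB: "e \<in> ring_hom C B"
    using Y by (auto simp: ring_hom_def B'_def)
  have cC: "c b \<in> carrier C" "e (c b) = b" if "b \<in> Y" for b
    using that iso cB' by (auto simp: e_def B'_def ring_iso_def ring_hom_def)
  have chom: "c \<in> ring_hom B' C" using iso by (simp add: ring_iso_def)
  have hB': "h \<in> ring_hom S B'"
    using hh hY by (auto simp: ring_hom_def B'_def)
  define h' where "h' = c \<circ> h"
  define \<psi>' where "\<psi>' = h' \<circ> \<phi>"
  have h': "h' \<in> ring_hom S C" unfolding h'_def by (rule ring_hom_trans[OF hB' chom])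
  have \<psi>': "\<psi>' \<in> ring_hom R C" unfolding \<psi>'_def by (rule ring_hom_trans[OF RS.homh h'])
  have e\<psi>': "e (\<psi>' r) = \<psi> r" if "r \<in> carrier R" for r
    using h\<phi>[OF that] cC(2)[OF hY[OF RS.hom_closed[OF that]]] by (simp add: \<psi>'_def h'_def)
  have map: "map e (map \<psi>' xs) = map \<psi> xs"
    using e\<psi>' \<open>set xs \<subseteq> carrier R\<close> by auto
  have "regular_sequence C (map \<psi>' xs)"
  proof (rule regular_sequence_descends)
    show "ring_hom_cring C B e"
      by (intro ring_hom_cring.intro ring_hom_cring_axioms.intro Ccring RB.S.is_cring eB)
    show "inj_on e (carrier C)" using ebij by (simp add: bij_betw_def)
    show "set (map \<psi>' xs) \<subseteq> carrier C"
      using \<open>set xs \<subseteq> carrier R\<close> ring_hom_closed[OF \<psi>'] by auto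
    show "regular_sequence B (map e (map \<psi>' xs))" unfolding map by (rule reg)
    fix k b assume k: "k < length (map \<psi>' xs)" and b: "b \<in> carrier C"
      and m: "e b \<in> Idl\<^bsub>B\<^esub> (set (take (Suc k) (map e (map \<psi>' xs))))"
    have kx: "k < length xs" using k by simp
    have ebY: "e b \<in> Y" using ebij b by (auto simp: bij_betw_def)
    have yk: "?y ! k \<in> carrier B" using kx xsR by simp
    have tk: "set (take k ?y) \<subseteq> carrier B"
      using \<open>set xs \<subseteq> carrier R\<close> by (auto simp: take_map dest!: in_set_takeD)
    have "set (take (Suc k) ?y) = insert (?y ! k) (set (take k ?y))"
      using kx by (simp add: take_Suc_conv_app_nth)
    then have "e b \<in> Idl\<^bsub>B\<^esub> (insert (?y ! k) (set (take k ?y)))"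
      using m unfolding map by simp
    then have "\<exists>c. ?P k (e b) c"
      using RB.S.mem_Idl_insert_iff[OF yk tk, of "e b"] ebY Y by blast
    then have P: "?P k (e b) (co k (e b))" by (rule co)
    define d where "d = c (co k (e b))"
    have d: "d \<in> carrier C" "e d = co k (e b)" using cC[OF coY[OF ebY]] by (auto simp: d_def)
    have "e (map \<psi>' xs ! k) = ?y ! k" using kx xsR e\<psi>' by simp
    then show "\<exists>c \<in> carrier C. e b \<ominus>\<^bsub>B\<^esub> e c \<otimes>\<^bsub>B\<^esub> e (map \<psi>' xs ! k)
        \<in> Idl\<^bsub>B\<^esub> (set (take k (map e (map \<psi>' xs))))"
      unfolding map using P d by (intro bexI[of _ d]) simp_all
  qed
  moreover have "ring_hom_cring R C \<psi>'"
    by (intro ring_hom_cring.intro ring_hom_cring_axioms.intro Ccring RS.R.is_cring \<psi>')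
  ultimately have "big_CM_algebra R C \<psi>'"
    unfolding big_CM_algebra_def using xs by blast
  moreover have "h' \<in> algebra_hom R S \<phi> C \<psi>'"
    unfolding algebra_hom_def using h' by (simp add: \<psi>'_def)
  ultimately show ?thesis unfolding seed_def using S by blast
qed

end

theory Submission
  imports Defs
begin

text \<open>
  Let \<open>h\<close> map the minimal seed \<open>S\<close> to a big Cohen-Macaulay algebra \<open>B\<close>, let \<open>x\<^sub>1, \<dots>, x\<^sub>d\<close> be
  parameters that are regular on \<open>B\<close>, and let \<open>ab = 0\<close> in \<open>S\<close>.  Minimality means that a homomorphism
  from \<open>S\<close> to a big Cohen-Macaulay algebra is injective, because \<open>S\<close> modulo its kernel is again a
  seed (\<open>minimal_seed_hom_injective\<close>).  So it suffices to find a big Cohen-Macaulay algebra in which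
  \<open>a\<close> or \<open>b\<close> vanishes.

  In characteristic \<open>p\<close> the map \<open>\<Delta>\<close> that sends \<open>x\<close> to the sequence of its powers \<open>x^(p^e)\<close> is a ring
  homomorphism from \<open>B\<close> to the ring \<open>P\<close> of all sequences in \<open>B\<close>.  Powers of a regular sequence form a
  regular sequence, so the \<open>\<Delta> x\<^sub>i\<close> are a regular sequence on \<open>P\<close>.  The constant sequence \<open>\<alpha>\<close> with
  entries \<open>h a\<close> now plays the part of a family of \<open>p^e\<close>-th roots of \<open>a\<close>, and the entry \<open>h b^(p^e)\<close>
  of \<open>\<Delta> (h b)\<close> is killed by it.  Two cases remain.

  If no power of \<open>h a\<close> lies in all the ideals \<open>(x\<^sub>1^(p^e), \<dots>, x\<^sub>d^(p^e))B\<close>, then no power of \<open>\<alpha>\<close> lies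
  in the ideal of \<open>P\<close> generated by the \<open>\<Delta> x\<^sub>i\<close>.  Inverting \<open>\<alpha>\<close> therefore keeps the sequence
  regular (\<open>regular_sequence_fraction_ring\<close>), and \<open>b\<close> becomes \<open>0\<close> since \<open>\<alpha> \<otimes> \<Delta> (h b) = \<zero>\<close>.

  Otherwise some power \<open>h a^k\<close> lies in all these ideals, and an algebra is needed that is separated for
  the topology defined by the \<open>x\<^sub>i\<close>.  The residue class ring of \<open>P\<close> modulo the ideal of sequences
  whose \<open>e\<close>-th entry lies in \<open>(x\<^sub>1^(p^e (e-k)), \<dots>, x\<^sub>d^(p^e (e-k)))B\<close> for all large \<open>e\<close> and some
  fixed \<open>k\<close> has this effect.  The sequence stays regular on it because division by \<open>x\<^sub>i\<close> costs just
  one unit of \<open>k\<close> (\<open>regular_sequence_approximate\<close>, \<open>regular_sequence_Quot_null_sequences\<close>), and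
  \<open>\<Delta> (h a)\<close> lies in that ideal, so \<open>a\<close> becomes \<open>0\<close>.
\<close>

section \<open>Regular sequences modulo an ideal, and powers\<close>

context cring begin

text \<open>
  The ideals are represented by generating sets throughout, so that adjoining the next member of a
  sequence, or exchanging one generator for a power of it, is an operation on sets.
\<close>
definition nonzerodivisor_mod :: "'a set \<Rightarrow> 'a \<Rightarrow> bool" where
  "nonzerodivisor_mod A y \<longleftrightarrow> (\<forall>b \<in> carrier R. y \<otimes> b \<in> Idl A \<longrightarrow> b \<in> Idl A)"

text \<open>
  Regularity modulo \<open>Idl A\<close>, without the requirement that the sequence generate a proper ideal.
  The exchange arguments below run by induction along the sequence, with \<open>A\<close> absorbing the members
  already passed.
\<close>
primrec weakly_regular :: "'a set \<Rightarrow> 'a list \<Rightarrow> bool" where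
  "weakly_regular A [] = True"
| "weakly_regular A (y # ys) = (nonzerodivisor_mod A y \<and> weakly_regular (insert y A) ys)"

lemma Idl_mono:
  assumes "A \<subseteq> Idl B" "B \<subseteq> carrier R"
  shows "Idl A \<subseteq> Idl B"
  using assms by (intro genideal_minimal genideal_ideal)

lemma Idl_eq_carrier_iff:
  assumes "A \<subseteq> carrier R"
  shows "Idl A = carrier R \<longleftrightarrow> \<one> \<in> Idl A"
  using ideal.one_imp_carrier[OF genideal_ideal[OF assms]] by auto

lemma power_mem_Idl:
  assumes "x \<in> Idl A" "A \<subseteq> carrier R" "0 < (n::nat)"
  shows "x [^] n \<in> Idl A"
proof -
  interpret I: ideal "Idl A" R by (rule genideal_ideal[OF assms(2)])
  obtain m where "n = Suc m" using assms(3) by (cases n) auto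
  then show ?thesis using I.I_l_closed[OF assms(1), of "x [^] m"] I.Icarr[OF assms(1)] by simp
qed

lemma Idl_powers_antimono:
  assumes "A \<subseteq> carrier R" "m \<le> (n::nat)"
  shows "Idl ((\<lambda>x. x [^] n) ` A) \<subseteq> Idl ((\<lambda>x. x [^] m) ` A)"
proof (rule Idl_mono)
  show B: "(\<lambda>x. x [^] m) ` A \<subseteq> carrier R" using assms by auto
  interpret I: ideal "Idl ((\<lambda>x. x [^] m) ` A)" R by (rule genideal_ideal[OF B])
  show "(\<lambda>x. x [^] n) ` A \<subseteq> Idl ((\<lambda>x. x [^] m) ` A)"
  proof safe
    fix x assume x: "x \<in> A"
    then have xc: "x \<in> carrier R" using assms by auto
    have "x [^] m \<in> Idl ((\<lambda>x. x [^] m) ` A)" using genideal_self[OF B] x by auto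
    then have "x [^] (n - m) \<otimes> x [^] m \<in> Idl ((\<lambda>x. x [^] m) ` A)"
      using xc by (intro I.I_l_closed) auto
    then show "x [^] n \<in> Idl ((\<lambda>x. x [^] m) ` A)" using xc assms(2) by (simp add: nat_pow_mult)
  qed
qed

lemma nonzerodivisor_mod_pow:
  assumes "y \<in> carrier R" "nonzerodivisor_mod A y"
  shows "nonzerodivisor_mod A (y [^] (m::nat))"
proof (induction m)
  case 0 then show ?case by (simp add: nonzerodivisor_mod_def)
next
  case (Suc m)
  show ?case unfolding nonzerodivisor_mod_def
  proof safe
    fix b assume b: "b \<in> carrier R" "y [^] Suc m \<otimes> b \<in> Idl A"
    then have "y [^] m \<otimes> (y \<otimes> b) \<in> Idl A" using assms by (simp add: m_assoc)
    then show "b \<in> Idl A" using Suc assms b unfolding nonzerodivisor_mod_def by blast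
  qed
qed

text \<open>
  The first of two consecutive members of a regular sequence stays regular in the second place
  (the second one need not be regular in the first).  If \<open>yb = cz\<close> modulo \<open>A\<close>, then
  \<open>c\<close> is a multiple \<open>dy\<close> of \<open>y\<close>, because \<open>z\<close> is regular modulo \<open>y\<close>; cancelling \<open>y\<close> gives \<open>b = dz\<close>.
\<close>
lemma nonzerodivisor_mod_swap:
  assumes y: "y \<in> carrier R" and z: "z \<in> carrier R" and A: "A \<subseteq> carrier R"
    and ny: "nonzerodivisor_mod A y" and nz: "nonzerodivisor_mod (insert y A) z"
  shows "nonzerodivisor_mod (insert z A) y"
  unfolding nonzerodivisor_mod_def
proof safe
  interpret I: ideal "Idl A" R by (rule genideal_ideal[OF A])
  fix b assume b: "b \<in> carrier R" "y \<otimes> b \<in> Idl (insert z A)"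
  then obtain c where c: "c \<in> carrier R" "y \<otimes> b \<ominus> c \<otimes> z \<in> Idl A"
    using mem_Idl_insert_iff[OF z A, of "y \<otimes> b"] y by auto
  have "z \<otimes> c \<ominus> b \<otimes> y = \<ominus> (y \<otimes> b \<ominus> c \<otimes> z)" using y z b(1) c(1) by algebra
  then have "z \<otimes> c \<ominus> b \<otimes> y \<in> Idl A" using c(2) by simp
  then have "z \<otimes> c \<in> Idl (insert y A)"
    using mem_Idl_insert_iff[OF y A, of "z \<otimes> c"] z b(1) c(1) by auto
  then have "c \<in> Idl (insert y A)" using nz c(1) unfolding nonzerodivisor_mod_def by blast
  then obtain d where d: "d \<in> carrier R" "c \<ominus> d \<otimes> y \<in> Idl A"
    using mem_Idl_insert_iff[OF y A c(1)] by auto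
  have "y \<otimes> (b \<ominus> d \<otimes> z) = (y \<otimes> b \<ominus> c \<otimes> z) \<oplus> z \<otimes> (c \<ominus> d \<otimes> y)"
    using y z b(1) c(1) d(1) by algebra
  then have "y \<otimes> (b \<ominus> d \<otimes> z) \<in> Idl A" using c(2) I.I_l_closed[OF d(2) z] by simp
  then have "b \<ominus> d \<otimes> z \<in> Idl A" using ny b(1) d(1) z unfolding nonzerodivisor_mod_def by blast
  then show "b \<in> Idl (insert z A)" using mem_Idl_insert_iff[OF z A b(1)] d(1) by auto
qed

text \<open>
  If \<open>z b\<close> is a multiple \<open>c y^(m+1)\<close>, induction gives \<open>b = e y^m\<close>.  Cancelling \<open>y^m\<close> leaves
  \<open>z e = c y\<close>, so \<open>e\<close> is a multiple of \<open>y\<close> and \<open>b\<close> is a multiple of \<open>y^(m+1)\<close>.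
\<close>
lemma nonzerodivisor_mod_insert_pow:
  assumes y: "y \<in> carrier R" and z: "z \<in> carrier R" and A: "A \<subseteq> carrier R"
    and ny: "nonzerodivisor_mod A y" and nz: "nonzerodivisor_mod (insert y A) z"
  shows "nonzerodivisor_mod (insert (y [^] (m::nat)) A) z"
proof (induction m)
  case 0
  have "insert \<one> A \<subseteq> carrier R" using A by simp
  then have "Idl (insert \<one> A) = carrier R"
    using Idl_eq_carrier_iff genideal_self by blast
  then show ?case using z by (simp add: nonzerodivisor_mod_def)
next
  case (Suc m)
  interpret I: ideal "Idl A" R by (rule genideal_ideal[OF A])
  have ym: "y [^] m \<in> carrier R" "y [^] Suc m \<in> carrier R" using y by simp_all
  show ?case unfolding nonzerodivisor_mod_def
  proof safe
    fix b assume b: "b \<in> carrier R" "z \<otimes> b \<in> Idl (insert (y [^] Suc m) A)"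
    then obtain c where c: "c \<in> carrier R" "z \<otimes> b \<ominus> c \<otimes> y [^] Suc m \<in> Idl A"
      using mem_Idl_insert_iff[OF ym(2) A, of "z \<otimes> b"] z by auto
    have "c \<otimes> y [^] Suc m = (c \<otimes> y) \<otimes> y [^] m" using c(1) y ym by (simp add: m_ac)
    then have "z \<otimes> b \<ominus> (c \<otimes> y) \<otimes> y [^] m \<in> Idl A" using c(2) by simp
    then have "z \<otimes> b \<in> Idl (insert (y [^] m) A)"
      using mem_Idl_insert_iff[OF ym(1) A, of "z \<otimes> b"] z b(1) m_closed[OF c(1) y] by blast
    then have "b \<in> Idl (insert (y [^] m) A)" using Suc b(1) unfolding nonzerodivisor_mod_def by blast
    then obtain e where e: "e \<in> carrier R" "b \<ominus> e \<otimes> y [^] m \<in> Idl A"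
      using mem_Idl_insert_iff[OF ym(1) A b(1)] by auto
    have "y [^] m \<otimes> (z \<otimes> e \<ominus> c \<otimes> y)
        = (z \<otimes> b \<ominus> c \<otimes> y [^] Suc m) \<ominus> z \<otimes> (b \<ominus> e \<otimes> y [^] m)"
      unfolding nat_pow_Suc using y z ym(1) b(1) c(1) e(1) by algebra
    then have "y [^] m \<otimes> (z \<otimes> e \<ominus> c \<otimes> y) \<in> Idl A"
      using c(2) I.I_l_closed[OF e(2) z] by (simp add: a_minus_def)
    then have "z \<otimes> e \<ominus> c \<otimes> y \<in> Idl A"
      using nonzerodivisor_mod_pow[OF y ny, of m] y z c(1) e(1) unfolding nonzerodivisor_mod_def by blast
    then have "z \<otimes> e \<in> Idl (insert y A)"
      using mem_Idl_insert_iff[OF y A, of "z \<otimes> e"] z c(1) e(1) by auto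
    then have "e \<in> Idl (insert y A)" using nz e(1) unfolding nonzerodivisor_mod_def by blast
    then obtain f where f: "f \<in> carrier R" "e \<ominus> f \<otimes> y \<in> Idl A"
      using mem_Idl_insert_iff[OF y A e(1)] by auto
    have "b \<ominus> f \<otimes> y [^] Suc m = (b \<ominus> e \<otimes> y [^] m) \<oplus> y [^] m \<otimes> (e \<ominus> f \<otimes> y)"
      unfolding nat_pow_Suc using y z ym(1) b(1) e(1) f(1) by algebra
    then have "b \<ominus> f \<otimes> y [^] Suc m \<in> Idl A"
      using e(2) I.I_l_closed[OF f(2) ym(1)] by simp
    then show "b \<in> Idl (insert (y [^] Suc m) A)"
      using mem_Idl_insert_iff[OF ym(2) A b(1)] f(1) by auto
  qed
qed

lemma weakly_regular_insert_pow:
  assumes "y \<in> carrier R" "A \<subseteq> carrier R" "set zs \<subseteq> carrier R"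
    and "nonzerodivisor_mod A y" "weakly_regular (insert y A) zs"
  shows "weakly_regular (insert (y [^] (m::nat)) A) zs"
  using assms
proof (induction zs arbitrary: A)
  case (Cons z zs)
  then have "nonzerodivisor_mod (insert z A) y" using nonzerodivisor_mod_swap[of y z A] by simp
  moreover have "nonzerodivisor_mod (insert (y [^] m) A) z"
    using Cons.prems nonzerodivisor_mod_insert_pow[of y z A m] by simp
  ultimately show ?case
    using Cons.IH[of "insert z A"] Cons.prems by (simp add: insert_commute)
qed simp

lemma weakly_regular_powers:
  assumes "A \<subseteq> carrier R" "set ys \<subseteq> carrier R" "weakly_regular A ys"
  shows "weakly_regular A (map (\<lambda>y. y [^] (m::nat)) ys)"
  using assms
proof (induction ys arbitrary: A)
  case (Cons y ys)
  then show ?case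
    using nonzerodivisor_mod_pow[of y A m] weakly_regular_insert_pow[of y A ys m]
      Cons.IH[of "insert (y [^] m) A"] by simp
qed simp

text \<open>
  Iterating the exchange moves \<open>y\<close> behind the whole sequence.
\<close>
lemma nonzerodivisor_mod_rest:
  assumes "y \<in> carrier R" "A \<subseteq> carrier R" "set zs \<subseteq> carrier R"
    and "nonzerodivisor_mod A y" "weakly_regular (insert y A) zs"
  shows "nonzerodivisor_mod (A \<union> set zs) y"
  using assms
proof (induction zs arbitrary: A)
  case (Cons z zs)
  then show ?case
    using nonzerodivisor_mod_swap[of y z A] Cons.IH[of "insert z A"] by (simp add: insert_commute)
qed simp

lemma weakly_regular_append:
  "weakly_regular A (us @ vs) \<longleftrightarrow> weakly_regular A us \<and> weakly_regular (A \<union> set us) vs"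
  by (induction us arbitrary: A) auto

lemma weakly_regular_iff_nth:
  "weakly_regular A ys \<longleftrightarrow> (\<forall>k < length ys. nonzerodivisor_mod (A \<union> set (take k ys)) (ys ! k))"
proof (induction ys arbitrary: A)
  case (Cons y ys)
  show ?case unfolding weakly_regular.simps Cons.IH
    by (auto simp: nth_Cons less_Suc_eq_0_disj)
qed simp

lemma regular_sequence_iff:
  "regular_sequence R ys \<longleftrightarrow>
     set ys \<subseteq> carrier R \<and> weakly_regular {} ys \<and> \<one> \<notin> Idl (set ys)"
  unfolding regular_sequence_def weakly_regular_iff_nth nonzerodivisor_mod_def
  using Idl_eq_carrier_iff[of "set ys"] by auto

lemma regular_sequence_powers:
  assumes "regular_sequence R ys" "0 < (m::nat)"
  shows "regular_sequence R (map (\<lambda>y. y [^] m) ys)"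
proof -
  have ys: "set ys \<subseteq> carrier R" "weakly_regular {} ys" "\<one> \<notin> Idl (set ys)"
    using assms(1) by (auto simp: regular_sequence_iff)
  have "(\<lambda>y. y [^] m) ` set ys \<subseteq> Idl (set ys)"
    using power_mem_Idl[OF _ ys(1) assms(2)] genideal_self[OF ys(1)] by auto
  then have "Idl ((\<lambda>y. y [^] m) ` set ys) \<subseteq> Idl (set ys)" using ys(1) by (rule Idl_mono)
  then show ?thesis
    using ys weakly_regular_powers[of "{}" ys m] by (auto simp: regular_sequence_iff)
qed

text \<open>
  This is the estimate behind the regularity of a regular sequence on the completion of a ring.  If
  the product of \<open>b\<close> with \<open>y = ys ! k\<close> vanishes modulo the earlier members \<open>us\<close> up to an error in the
  ideal of \<open>(m+1)\<close>-st powers, then \<open>b\<close> itself vanishes modulo \<open>us\<close> up to an error in the ideal of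
  \<open>m\<close>-th powers.  Of the powers in the error, those of \<open>us\<close> are absorbed by \<open>us\<close>, and that of \<open>y\<close> is a
  multiple of \<open>y\<close>, which leaves \<open>y \<otimes> (b \<ominus> w \<otimes> y^m)\<close> in the ideal generated by \<open>us\<close> and the powers
  of the later members \<open>zs\<close>.  Modulo that ideal \<open>y\<close> is regular, by the exchange lemmas.
\<close>
lemma regular_sequence_approximate:
  assumes reg: "regular_sequence R ys" and k: "k < length ys" and b: "b \<in> carrier R"
    and n: "n \<in> Idl ((\<lambda>y. y [^] Suc m) ` set ys)"
    and mem: "ys ! k \<otimes> b \<ominus> n \<in> Idl (set (take k ys))"
  shows "\<exists>n' \<in> Idl ((\<lambda>y. y [^] m) ` set ys). b \<ominus> n' \<in> Idl (set (take k ys))"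
proof -
  define y where "y = ys ! k"
  define us where "us = take k ys"
  define zs where "zs = drop (Suc k) ys"
  have split: "ys = us @ y # zs" using k by (simp add: us_def y_def zs_def id_take_nth_drop)
  have c: "set us \<subseteq> carrier R" "y \<in> carrier R" "set zs \<subseteq> carrier R"
    and w: "nonzerodivisor_mod (set us) y" "weakly_regular (insert y (set us)) zs"
    using reg split by (auto simp: regular_sequence_iff weakly_regular_append)
  let ?Z = "(\<lambda>z. z [^] Suc m) ` set zs" and ?Y = "\<lambda>m. (\<lambda>y. y [^] m) ` set ys"
  let ?D = "set us \<union> ?Z"
  have D: "?D \<subseteq> carrier R" using c by auto
  have Y: "?Y j \<subseteq> carrier R" for j :: nat using c split by auto
  have "weakly_regular (insert y (set us)) (map (\<lambda>z. z [^] Suc m) zs)"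
    using c w by (intro weakly_regular_powers) auto
  then have nzd: "nonzerodivisor_mod ?D y"
    using nonzerodivisor_mod_rest[of y "set us" "map (\<lambda>z. z [^] Suc m) zs"] c w(1) by auto
  have ym: "y [^] m \<in> carrier R" "y [^] Suc m \<in> carrier R" using c(2) by simp_all
  have E: "insert (y [^] Suc m) ?D \<subseteq> carrier R" using D ym by simp
  interpret E: ideal "Idl (insert (y [^] Suc m) ?D)" R by (rule genideal_ideal[OF E])
  interpret U: ideal "Idl (set us)" R by (rule genideal_ideal[OF c(1)])
  interpret YI: ideal "Idl (?Y m)" R by (rule genideal_ideal[OF Y])
  have nc: "n \<in> carrier R" using n ideal.Icarr[OF genideal_ideal[OF Y]] by blast
  have "set us \<subseteq> Idl (insert (y [^] Suc m) ?D)" using genideal_self[OF E] by blast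
  then have usE: "Idl (set us) \<subseteq> Idl (insert (y [^] Suc m) ?D)" using E by (rule Idl_mono)
  have "?Y (Suc m) \<subseteq> Idl (insert (y [^] Suc m) ?D)"
  proof safe
    fix v assume "v \<in> set ys"
    then consider "v \<in> set us" | "v = y" | "v \<in> set zs" using split by auto
    then show "v [^] Suc m \<in> Idl (insert (y [^] Suc m) ?D)"
    proof cases
      case 1
      then show ?thesis using genideal_self[OF E] E by (intro power_mem_Idl) auto
    qed (use genideal_self[OF E] in auto)
  qed
  then have "Idl (?Y (Suc m)) \<subseteq> Idl (insert (y [^] Suc m) ?D)" using E by (rule Idl_mono)
  then have "(y \<otimes> b \<ominus> n) \<oplus> n \<in> Idl (insert (y [^] Suc m) ?D)"
    using usE n mem by (intro E.a_closed) (auto simp: y_def us_def)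
  moreover have "(y \<otimes> b \<ominus> n) \<oplus> n = y \<otimes> b" using c(2) b nc by algebra
  ultimately obtain w where w: "w \<in> carrier R" "y \<otimes> b \<ominus> w \<otimes> y [^] Suc m \<in> Idl ?D"
    using mem_Idl_insert_iff[OF ym(2) D, of "y \<otimes> b"] b c(2) by auto
  have "y \<otimes> b \<ominus> w \<otimes> y [^] Suc m = y \<otimes> (b \<ominus> w \<otimes> y [^] m)"
    unfolding nat_pow_Suc using c(2) b w(1) ym(1) by algebra
  then have bw: "b \<ominus> w \<otimes> y [^] m \<in> Idl ?D"
    using nzd w b ym(1) unfolding nonzerodivisor_mod_def by auto
  have K: "ideal (Idl (set us) <+>\<^bsub>R\<^esub> Idl (?Y m)) R"
    by (rule add_ideals[OF U.ideal_axioms YI.ideal_axioms])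
  have inK: "i \<oplus> j \<in> Idl (set us) <+>\<^bsub>R\<^esub> Idl (?Y m)"
    if "i \<in> Idl (set us)" "j \<in> Idl (?Y m)" for i j
    using that unfolding set_add_def' by blast
  have "?D \<subseteq> Idl (set us) <+>\<^bsub>R\<^esub> Idl (?Y m)"
  proof
    fix v assume "v \<in> ?D"
    then consider "v \<in> set us" | z where "z \<in> set zs" "v = z [^] Suc m" by auto
    then show "v \<in> Idl (set us) <+>\<^bsub>R\<^esub> Idl (?Y m)"
    proof cases
      case 1
      then show ?thesis using inK[of v \<zero>] genideal_self[OF c(1)] YI.zero_closed U.Icarr by auto
    next
      case 2
      have "z [^] Suc m \<in> Idl (?Y (Suc m))" using 2 split genideal_self[OF Y, of "Suc m"] by auto
      then have "v \<in> Idl (?Y m)"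
        using 2 split Idl_powers_antimono[of "set ys" m "Suc m"] c by auto
      then show ?thesis using inK[of \<zero> v] U.zero_closed YI.Icarr by auto
    qed
  qed
  then have "Idl ?D \<subseteq> Idl (set us) <+>\<^bsub>R\<^esub> Idl (?Y m)" using K by (intro genideal_minimal)
  then obtain i j where ij: "i \<in> Idl (set us)" "j \<in> Idl (?Y m)" "b \<ominus> w \<otimes> y [^] m = i \<oplus> j"
    using bw unfolding set_add_def' by blast
  have ijc: "i \<in> carrier R" "j \<in> carrier R" using ij U.Icarr YI.Icarr by auto
  have "y [^] m \<in> Idl (?Y m)" using genideal_self[OF Y] split by auto
  then have "j \<oplus> w \<otimes> y [^] m \<in> Idl (?Y m)"
    using ij(2) YI.I_l_closed w(1) by (intro YI.a_closed) auto
  moreover have "b \<ominus> (j \<oplus> w \<otimes> y [^] m) = i"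
  proof -
    have "b \<ominus> (j \<oplus> w \<otimes> y [^] m) = (b \<ominus> w \<otimes> y [^] m) \<ominus> j"
      using b w(1) ym(1) ijc by algebra
    also have "\<dots> = i" unfolding ij(3) using ijc by algebra
    finally show ?thesis .
  qed
  ultimately show ?thesis using ij(1) unfolding us_def by auto
qed

end

section \<open>Rings of sequences\<close>

definition sequence_ring :: "('b, 'n) ring_scheme \<Rightarrow> (nat \<Rightarrow> 'b) ring" where
  "sequence_ring B = \<lparr>carrier = {u. \<forall>e. u e \<in> carrier B},
     monoid.mult = (\<lambda>u v e. u e \<otimes>\<^bsub>B\<^esub> v e), one = (\<lambda>e. \<one>\<^bsub>B\<^esub>),
     ring.zero = (\<lambda>e. \<zero>\<^bsub>B\<^esub>), ring.add = (\<lambda>u v e. u e \<oplus>\<^bsub>B\<^esub> v e)\<rparr>"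

lemma sequence_ring_simps [simp]:
  "u \<in> carrier (sequence_ring B) \<longleftrightarrow> (\<forall>e. u e \<in> carrier B)"
  "\<one>\<^bsub>sequence_ring B\<^esub> = (\<lambda>e. \<one>\<^bsub>B\<^esub>)" "\<zero>\<^bsub>sequence_ring B\<^esub> = (\<lambda>e. \<zero>\<^bsub>B\<^esub>)"
  "u \<otimes>\<^bsub>sequence_ring B\<^esub> v = (\<lambda>e. u e \<otimes>\<^bsub>B\<^esub> v e)"
  "u \<oplus>\<^bsub>sequence_ring B\<^esub> v = (\<lambda>e. u e \<oplus>\<^bsub>B\<^esub> v e)"
  by (simp_all add: sequence_ring_def)

lemma cring_sequence_ring:
  assumes "cring B"
  shows "cring (sequence_ring B)"
proof -
  interpret cring B by fact
  show ?thesis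
  proof (intro cringI abelian_groupI comm_monoidI)
    fix u assume "u \<in> carrier (sequence_ring B)"
    then show "\<exists>v \<in> carrier (sequence_ring B). v \<oplus>\<^bsub>sequence_ring B\<^esub> u = \<zero>\<^bsub>sequence_ring B\<^esub>"
      by (intro bexI[of _ "\<lambda>e. \<ominus>\<^bsub>B\<^esub> u e"]) (auto simp: l_neg)
  qed (auto simp: fun_eq_iff a_ac m_ac l_distr r_distr)
qed

lemma sequence_ring_a_inv:
  assumes "cring B" "u \<in> carrier (sequence_ring B)"
  shows "\<ominus>\<^bsub>sequence_ring B\<^esub> u = (\<lambda>e. \<ominus>\<^bsub>B\<^esub> u e)"
proof -
  interpret cring B by fact
  interpret P: cring "sequence_ring B" by (rule cring_sequence_ring) fact
  show ?thesis using assms(2) by (intro P.minus_equality) (auto simp: l_neg fun_eq_iff)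
qed

lemma sequence_ring_minus:
  assumes "cring B" "u \<in> carrier (sequence_ring B)" "v \<in> carrier (sequence_ring B)"
  shows "u \<ominus>\<^bsub>sequence_ring B\<^esub> v = (\<lambda>e. u e \<ominus>\<^bsub>B\<^esub> v e)"
  using sequence_ring_a_inv[OF assms(1,3)] by (simp add: a_minus_def)

lemma sequence_ring_pow:
  "u [^]\<^bsub>sequence_ring B\<^esub> (n::nat) = (\<lambda>e. u e [^]\<^bsub>B\<^esub> n)"
  by (induction n) (simp_all add: nat_pow_def)

text \<open>
  Membership in a finitely generated ideal is an entrywise matter, since the coefficients of the
  entries can be collected into sequences.  For infinitely many generators this can fail: the number of
  generators needed could grow with \<open>e\<close>.
\<close>
lemma mem_Idl_sequence_ring_iff:
  assumes B: "cring B" and ys: "set ys \<subseteq> carrier (sequence_ring B)"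
    and u: "u \<in> carrier (sequence_ring B)"
  shows "u \<in> Idl\<^bsub>sequence_ring B\<^esub> (set ys) \<longleftrightarrow> (\<forall>e. u e \<in> Idl\<^bsub>B\<^esub> ((\<lambda>y. y e) ` set ys))"
  using ys u
proof (induction ys arbitrary: u)
  case Nil
  interpret B: cring B by fact
  interpret P: cring "sequence_ring B" by (rule cring_sequence_ring) fact
  have "Idl\<^bsub>B\<^esub> {} = {\<zero>\<^bsub>B\<^esub>}"
    using B.genideal_minimal[OF B.zeroideal, of "{}"]
      additive_subgroup.zero_closed[OF ideal.axioms(1)[OF B.genideal_ideal[of "{}"]]] by auto
  moreover have "Idl\<^bsub>sequence_ring B\<^esub> {} = {\<zero>\<^bsub>sequence_ring B\<^esub>}"
    using P.genideal_minimal[OF P.zeroideal, of "{}"]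
      additive_subgroup.zero_closed[OF ideal.axioms(1)[OF P.genideal_ideal[of "{}"]]] by auto
  ultimately show ?case by (auto simp: fun_eq_iff)
next
  case (Cons y ys)
  interpret B: cring B by fact
  interpret P: cring "sequence_ring B" by (rule cring_sequence_ring) fact
  have y: "y \<in> carrier (sequence_ring B)" "\<And>e. y e \<in> carrier B"
    and yss: "set ys \<subseteq> carrier (sequence_ring B)" "\<And>e. (\<lambda>y. y e) ` set ys \<subseteq> carrier B"
    using Cons.prems(1) by auto
  have u: "u e \<in> carrier B" for e using Cons.prems(2) by simp
  have "u \<in> Idl\<^bsub>sequence_ring B\<^esub> (set (y # ys)) \<longleftrightarrow>
      (\<exists>c \<in> carrier (sequence_ring B). u \<ominus>\<^bsub>sequence_ring B\<^esub> c \<otimes>\<^bsub>sequence_ring B\<^esub> y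
         \<in> Idl\<^bsub>sequence_ring B\<^esub> (set ys))"
    using P.mem_Idl_insert_iff[OF y(1) yss(1) Cons.prems(2)] by simp
  also have "\<dots> \<longleftrightarrow> (\<exists>c \<in> carrier (sequence_ring B).
      \<forall>e. u e \<ominus>\<^bsub>B\<^esub> c e \<otimes>\<^bsub>B\<^esub> y e \<in> Idl\<^bsub>B\<^esub> ((\<lambda>y. y e) ` set ys))"
  proof (intro bex_cong refl)
    fix c assume c: "c \<in> carrier (sequence_ring B)"
    have cy: "c \<otimes>\<^bsub>sequence_ring B\<^esub> y \<in> carrier (sequence_ring B)" using c y(1) by (rule P.m_closed)
    show "u \<ominus>\<^bsub>sequence_ring B\<^esub> c \<otimes>\<^bsub>sequence_ring B\<^esub> y \<in> Idl\<^bsub>sequence_ring B\<^esub> (set ys) \<longleftrightarrow>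
      (\<forall>e. u e \<ominus>\<^bsub>B\<^esub> c e \<otimes>\<^bsub>B\<^esub> y e \<in> Idl\<^bsub>B\<^esub> ((\<lambda>y. y e) ` set ys))"
      using Cons.IH[OF yss(1) P.minus_closed[OF Cons.prems(2) cy]]
      unfolding sequence_ring_minus[OF B Cons.prems(2) cy] by simp
  qed
  also have "\<dots> \<longleftrightarrow>
      (\<forall>e. \<exists>c \<in> carrier B. u e \<ominus>\<^bsub>B\<^esub> c \<otimes>\<^bsub>B\<^esub> y e \<in> Idl\<^bsub>B\<^esub> ((\<lambda>y. y e) ` set ys))"
    using choice[of "\<lambda>e c. c \<in> carrier B \<and>
        u e \<ominus>\<^bsub>B\<^esub> c \<otimes>\<^bsub>B\<^esub> y e \<in> Idl\<^bsub>B\<^esub> ((\<lambda>y. y e) ` set ys)"]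
    by (auto simp: Bex_def)
  also have "\<dots> \<longleftrightarrow> (\<forall>e. u e \<in> Idl\<^bsub>B\<^esub> (insert (y e) ((\<lambda>y. y e) ` set ys)))"
    using B.mem_Idl_insert_iff[OF y(2) yss(2) u] by simp
  finally show ?case by simp
qed

lemma regular_sequence_sequence_ring:
  assumes B: "cring B" and ys: "set ys \<subseteq> carrier (sequence_ring B)"
    and reg: "\<And>e. regular_sequence B (map (\<lambda>y. y e) ys)"
  shows "regular_sequence (sequence_ring B) ys"
proof -
  interpret B: cring B by fact
  interpret P: cring "sequence_ring B" by (rule cring_sequence_ring) fact
  show ?thesis unfolding regular_sequence_def
  proof (intro conjI allI impI ballI)
    fix k u assume k: "k < length ys" and u: "u \<in> carrier (sequence_ring B)"
      and m: "ys ! k \<otimes>\<^bsub>sequence_ring B\<^esub> u \<in> Idl\<^bsub>sequence_ring B\<^esub> (set (take k ys))"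
    have yk: "ys ! k \<in> carrier (sequence_ring B)" using k ys nth_mem by blast
    have tk: "set (take k ys) \<subseteq> carrier (sequence_ring B)" using ys set_take_subset by fast
    have "(ys ! k) e \<otimes>\<^bsub>B\<^esub> u e \<in> Idl\<^bsub>B\<^esub> ((\<lambda>y. y e) ` set (take k ys))" for e
      using m mem_Idl_sequence_ring_iff[OF B tk P.m_closed[OF yk u]] by simp
    then have "u e \<in> Idl\<^bsub>B\<^esub> ((\<lambda>y. y e) ` set (take k ys))" for e
      using reg[of e] k u unfolding regular_sequence_def by (auto simp: take_map)
    then show "u \<in> Idl\<^bsub>sequence_ring B\<^esub> (set (take k ys))"
      using mem_Idl_sequence_ring_iff[OF B tk u] by simp
  next
    have "\<one>\<^bsub>B\<^esub> \<notin> Idl\<^bsub>B\<^esub> ((\<lambda>y. y 0) ` set ys)"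
      using reg[of 0] unfolding B.regular_sequence_iff by simp
    then have "\<one>\<^bsub>sequence_ring B\<^esub> \<notin> Idl\<^bsub>sequence_ring B\<^esub> (set ys)"
      using mem_Idl_sequence_ring_iff[OF B ys P.one_closed] by auto
    then show "Idl\<^bsub>sequence_ring B\<^esub> (set ys) \<noteq> carrier (sequence_ring B)"
      using P.one_closed by metis
  qed (rule ys)
qed

section \<open>Regular sequences in rings of fractions and residue class rings\<close>

text \<open>
  The hypotheses say that \<open>C\<close> consists of fractions \<open>\<pi> u / \<pi> w\<close> with denominators \<open>w \<in> W\<close>.  They
  cover rings of fractions as well as residue class rings, for which \<open>W = {\<one>}\<close>, so that both
  constructions share one treatment of regular sequences.
\<close>
lemma mem_Idl_fractions_iff:
  assumes \<pi>: "ring_hom_cring P C \<pi>"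
    and W: "W \<subseteq> carrier P" "\<one>\<^bsub>P\<^esub> \<in> W" "\<And>v w. v \<in> W \<Longrightarrow> w \<in> W \<Longrightarrow> v \<otimes>\<^bsub>P\<^esub> w \<in> W"
    and unit: "\<And>w. w \<in> W \<Longrightarrow> \<exists>v \<in> carrier C. \<pi> w \<otimes>\<^bsub>C\<^esub> v = \<one>\<^bsub>C\<^esub>"
    and frac: "\<And>c. c \<in> carrier C \<Longrightarrow> \<exists>w \<in> W. \<exists>u \<in> carrier P. \<pi> w \<otimes>\<^bsub>C\<^esub> c = \<pi> u"
    and A: "A \<subseteq> carrier P" and c: "c \<in> carrier C"
  shows "c \<in> Idl\<^bsub>C\<^esub> (\<pi> ` A) \<longleftrightarrow> (\<exists>w \<in> W. \<exists>v \<in> Idl\<^bsub>P\<^esub> A. \<pi> w \<otimes>\<^bsub>C\<^esub> c = \<pi> v)"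
proof -
  interpret ring_hom_cring P C \<pi> by fact
  interpret I: ideal "Idl\<^bsub>P\<^esub> A" P by (rule R.genideal_ideal[OF A])
  have \<pi>A: "\<pi> ` A \<subseteq> carrier C" using A by auto
  interpret J: ideal "Idl\<^bsub>C\<^esub> (\<pi> ` A)" C by (rule S.genideal_ideal[OF \<pi>A])
  let ?K = "{c \<in> carrier C. \<exists>w \<in> W. \<exists>v \<in> Idl\<^bsub>P\<^esub> A. \<pi> w \<otimes>\<^bsub>C\<^esub> c = \<pi> v}"
  have "ideal ?K C"
  proof (rule idealI[OF S.ring_axioms])
    show "subgroup ?K (add_monoid C)"
    proof (rule S.add.subgroupI)
      show "?K \<noteq> {}"
      proof -
        have "\<pi> \<one>\<^bsub>P\<^esub> \<otimes>\<^bsub>C\<^esub> \<zero>\<^bsub>C\<^esub> = \<pi> \<zero>\<^bsub>P\<^esub>" by simp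
        then have "\<zero>\<^bsub>C\<^esub> \<in> ?K" using W(2) I.zero_closed S.zero_closed by blast
        then show ?thesis by blast
      qed
    next
      fix c assume "c \<in> ?K"
      then obtain w v where *: "c \<in> carrier C" "w \<in> W" "v \<in> Idl\<^bsub>P\<^esub> A" "\<pi> w \<otimes>\<^bsub>C\<^esub> c = \<pi> v"
        by blast
      then have "\<pi> w \<otimes>\<^bsub>C\<^esub> (\<ominus>\<^bsub>C\<^esub> c) = \<pi> (\<ominus>\<^bsub>P\<^esub> v)"
        using W(1) I.Icarr by (simp add: S.r_minus subset_iff)
      then show "\<ominus>\<^bsub>C\<^esub> c \<in> ?K" using * by blast
    next
      fix c d assume "c \<in> ?K" "d \<in> ?K"
      then obtain w v w' v' where *: "c \<in> carrier C" "w \<in> W" "v \<in> Idl\<^bsub>P\<^esub> A" "\<pi> w \<otimes>\<^bsub>C\<^esub> c = \<pi> v"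
        "d \<in> carrier C" "w' \<in> W" "v' \<in> Idl\<^bsub>P\<^esub> A" "\<pi> w' \<otimes>\<^bsub>C\<^esub> d = \<pi> v'"
        by blast
      have cl: "w \<in> carrier P" "w' \<in> carrier P" "v \<in> carrier P" "v' \<in> carrier P"
        using * W(1) I.Icarr by auto
      then have cl': "\<pi> w \<in> carrier C" "\<pi> w' \<in> carrier C" by auto
      have "\<pi> (w \<otimes>\<^bsub>P\<^esub> w') \<otimes>\<^bsub>C\<^esub> (c \<oplus>\<^bsub>C\<^esub> d)
          = \<pi> w' \<otimes>\<^bsub>C\<^esub> (\<pi> w \<otimes>\<^bsub>C\<^esub> c) \<oplus>\<^bsub>C\<^esub> \<pi> w \<otimes>\<^bsub>C\<^esub> (\<pi> w' \<otimes>\<^bsub>C\<^esub> d)"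
        unfolding hom_mult[OF cl(1,2)] using cl' *(1,5) by algebra
      also have "\<dots> = \<pi> (w' \<otimes>\<^bsub>P\<^esub> v \<oplus>\<^bsub>P\<^esub> w \<otimes>\<^bsub>P\<^esub> v')" using cl * by simp
      finally have "\<pi> (w \<otimes>\<^bsub>P\<^esub> w') \<otimes>\<^bsub>C\<^esub> (c \<oplus>\<^bsub>C\<^esub> d) = \<pi> (w' \<otimes>\<^bsub>P\<^esub> v \<oplus>\<^bsub>P\<^esub> w \<otimes>\<^bsub>P\<^esub> v')" .
      moreover have "w' \<otimes>\<^bsub>P\<^esub> v \<oplus>\<^bsub>P\<^esub> w \<otimes>\<^bsub>P\<^esub> v' \<in> Idl\<^bsub>P\<^esub> A"
        using * cl I.I_l_closed by (intro I.a_closed) auto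
      ultimately show "c \<oplus>\<^bsub>C\<^esub> d \<in> ?K" using *(1,5) W(3)[OF *(2,6)] by blast
    qed auto
  next
    fix c d assume "c \<in> ?K" and d: "d \<in> carrier C"
    then obtain w v where *: "c \<in> carrier C" "w \<in> W" "v \<in> Idl\<^bsub>P\<^esub> A" "\<pi> w \<otimes>\<^bsub>C\<^esub> c = \<pi> v"
      by blast
    obtain t u where tu: "t \<in> W" "u \<in> carrier P" "\<pi> t \<otimes>\<^bsub>C\<^esub> d = \<pi> u" using frac[OF d] by blast
    have cl: "w \<in> carrier P" "t \<in> carrier P" "v \<in> carrier P" using * tu W(1) I.Icarr by auto
    then have cl': "\<pi> w \<in> carrier C" "\<pi> t \<in> carrier C" by auto
    have "\<pi> (w \<otimes>\<^bsub>P\<^esub> t) \<otimes>\<^bsub>C\<^esub> (d \<otimes>\<^bsub>C\<^esub> c) = (\<pi> t \<otimes>\<^bsub>C\<^esub> d) \<otimes>\<^bsub>C\<^esub> (\<pi> w \<otimes>\<^bsub>C\<^esub> c)"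
      unfolding hom_mult[OF cl(1,2)] using cl' *(1) d by algebra
    also have "\<dots> = \<pi> (u \<otimes>\<^bsub>P\<^esub> v)" using tu cl * by simp
    finally show "d \<otimes>\<^bsub>C\<^esub> c \<in> ?K"
      using d *(1) W(3)[OF *(2) tu(1)] I.I_l_closed[OF *(3) tu(2)] by blast
    then show "c \<otimes>\<^bsub>C\<^esub> d \<in> ?K" using d *(1) by (simp add: S.m_comm)
  qed
  moreover have "\<pi> ` A \<subseteq> ?K"
  proof safe
    fix a assume a: "a \<in> A"
    then have "a \<in> carrier P" "a \<in> Idl\<^bsub>P\<^esub> A" using A R.genideal_self[OF A] by auto
    moreover have "\<pi> \<one>\<^bsub>P\<^esub> \<otimes>\<^bsub>C\<^esub> \<pi> a = \<pi> a" using \<open>a \<in> carrier P\<close> by simp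
    ultimately show "\<pi> a \<in> carrier C"
      "\<exists>w \<in> W. \<exists>v \<in> Idl\<^bsub>P\<^esub> A. \<pi> w \<otimes>\<^bsub>C\<^esub> \<pi> a = \<pi> v"
      using W(2) by (auto simp del: hom_one)
  qed
  ultimately have K: "Idl\<^bsub>C\<^esub> (\<pi> ` A) \<subseteq> ?K" by (rule S.genideal_minimal)
  have "ideal {v \<in> carrier P. \<pi> v \<in> Idl\<^bsub>C\<^esub> (\<pi> ` A)} P"
    by (rule ring_hom_ring.ideal_vimage[OF ring_hom_ringI2[OF R.ring_axioms S.ring_axioms homh] J.ideal_axioms])
  moreover have "A \<subseteq> {v \<in> carrier P. \<pi> v \<in> Idl\<^bsub>C\<^esub> (\<pi> ` A)}"
    using A S.genideal_self[OF \<pi>A] by auto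
  ultimately have *: "Idl\<^bsub>P\<^esub> A \<subseteq> {v \<in> carrier P. \<pi> v \<in> Idl\<^bsub>C\<^esub> (\<pi> ` A)}"
    by (rule R.genideal_minimal)
  show ?thesis
  proof
    assume "c \<in> Idl\<^bsub>C\<^esub> (\<pi> ` A)"
    then show "\<exists>w \<in> W. \<exists>v \<in> Idl\<^bsub>P\<^esub> A. \<pi> w \<otimes>\<^bsub>C\<^esub> c = \<pi> v" using K by blast
  next
    assume "\<exists>w \<in> W. \<exists>v \<in> Idl\<^bsub>P\<^esub> A. \<pi> w \<otimes>\<^bsub>C\<^esub> c = \<pi> v"
    then obtain w v where wv: "w \<in> W" "v \<in> Idl\<^bsub>P\<^esub> A" "\<pi> w \<otimes>\<^bsub>C\<^esub> c = \<pi> v" by blast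
    obtain x where x: "x \<in> carrier C" "\<pi> w \<otimes>\<^bsub>C\<^esub> x = \<one>\<^bsub>C\<^esub>" using unit[OF wv(1)] by blast
    have wc: "\<pi> w \<in> carrier C" using wv(1) W(1) by auto
    have "c = (\<pi> w \<otimes>\<^bsub>C\<^esub> x) \<otimes>\<^bsub>C\<^esub> c" using x(2) c by simp
    also have "\<dots> = x \<otimes>\<^bsub>C\<^esub> (\<pi> w \<otimes>\<^bsub>C\<^esub> c)" using x(1) c wc by (simp add: S.m_ac)
    also have "\<dots> \<in> Idl\<^bsub>C\<^esub> (\<pi> ` A)"
      unfolding wv(3) using * wv(2) x(1) by (intro J.I_l_closed) auto
    finally show "c \<in> Idl\<^bsub>C\<^esub> (\<pi> ` A)" .
  qed
qed

text \<open>
  Regularity on a ring of fractions, read off from equations between images of elements of \<open>P\<close>: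
  denominators can be cleared on both sides of the defining implication.
\<close>
lemma regular_sequence_fractions:
  assumes \<pi>: "ring_hom_cring P C \<pi>"
    and W: "W \<subseteq> carrier P" "\<one>\<^bsub>P\<^esub> \<in> W" "\<And>v w. v \<in> W \<Longrightarrow> w \<in> W \<Longrightarrow> v \<otimes>\<^bsub>P\<^esub> w \<in> W"
    and unit: "\<And>w. w \<in> W \<Longrightarrow> \<exists>v \<in> carrier C. \<pi> w \<otimes>\<^bsub>C\<^esub> v = \<one>\<^bsub>C\<^esub>"
    and frac: "\<And>c. c \<in> carrier C \<Longrightarrow> \<exists>w \<in> W. \<exists>u \<in> carrier P. \<pi> w \<otimes>\<^bsub>C\<^esub> c = \<pi> u"
    and ys: "set ys \<subseteq> carrier P"
    and nzd: "\<And>k u v. k < length ys \<Longrightarrow> u \<in> carrier P \<Longrightarrow> v \<in> Idl\<^bsub>P\<^esub> (set (take k ys)) \<Longrightarrow>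
      \<pi> (ys ! k \<otimes>\<^bsub>P\<^esub> u) = \<pi> v \<Longrightarrow> \<exists>w \<in> W. \<exists>v' \<in> Idl\<^bsub>P\<^esub> (set (take k ys)). \<pi> (w \<otimes>\<^bsub>P\<^esub> u) = \<pi> v'"
    and proper: "\<And>w v. w \<in> W \<Longrightarrow> v \<in> Idl\<^bsub>P\<^esub> (set ys) \<Longrightarrow> \<pi> w \<noteq> \<pi> v"
  shows "regular_sequence C (map \<pi> ys)"
proof -
  interpret ring_hom_cring P C \<pi> by fact
  have mem: "c \<in> Idl\<^bsub>C\<^esub> (\<pi> ` A) \<longleftrightarrow> (\<exists>w \<in> W. \<exists>v \<in> Idl\<^bsub>P\<^esub> A. \<pi> w \<otimes>\<^bsub>C\<^esub> c = \<pi> v)"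
    if "A \<subseteq> carrier P" "c \<in> carrier C" for A c
    by (rule mem_Idl_fractions_iff[OF \<pi> W(1,2)]) (use W(3) unit frac that in blast)+
  have tk: "set (take k ys) \<subseteq> carrier P" for k using ys set_take_subset by fast
  show ?thesis unfolding regular_sequence_def
  proof (intro conjI allI impI ballI)
    show "set (map \<pi> ys) \<subseteq> carrier C" using ys by auto
  next
    fix k c assume "k < length (map \<pi> ys)" and c: "c \<in> carrier C"
      and m: "map \<pi> ys ! k \<otimes>\<^bsub>C\<^esub> c \<in> Idl\<^bsub>C\<^esub> (set (take k (map \<pi> ys)))"
    then have k: "k < length ys" by simp
    have yk: "ys ! k \<in> carrier P" using ys k by auto
    have "\<pi> (ys ! k) \<otimes>\<^bsub>C\<^esub> c \<in> Idl\<^bsub>C\<^esub> (\<pi> ` set (take k ys))"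
      using m k by (simp add: take_map)
    then obtain w v where wv: "w \<in> W" "v \<in> Idl\<^bsub>P\<^esub> (set (take k ys))"
      "\<pi> w \<otimes>\<^bsub>C\<^esub> (\<pi> (ys ! k) \<otimes>\<^bsub>C\<^esub> c) = \<pi> v"
      using mem[OF tk, of "\<pi> (ys ! k) \<otimes>\<^bsub>C\<^esub> c" k] yk c by auto
    obtain t u where tu: "t \<in> W" "u \<in> carrier P" "\<pi> t \<otimes>\<^bsub>C\<^esub> c = \<pi> u" using frac[OF c] by blast
    have cl: "w \<in> carrier P" "t \<in> carrier P" "v \<in> carrier P"
      using wv tu W(1) ideal.Icarr[OF R.genideal_ideal[OF tk]] by auto
    then have cl': "\<pi> w \<in> carrier C" "\<pi> t \<in> carrier C" "\<pi> (ys ! k) \<in> carrier C" using yk by auto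
    have "\<pi> (ys ! k \<otimes>\<^bsub>P\<^esub> (w \<otimes>\<^bsub>P\<^esub> u)) = \<pi> (ys ! k) \<otimes>\<^bsub>C\<^esub> (\<pi> w \<otimes>\<^bsub>C\<^esub> (\<pi> t \<otimes>\<^bsub>C\<^esub> c))"
      using cl yk tu by simp
    also have "\<dots> = \<pi> t \<otimes>\<^bsub>C\<^esub> (\<pi> w \<otimes>\<^bsub>C\<^esub> (\<pi> (ys ! k) \<otimes>\<^bsub>C\<^esub> c))"
      using cl' c by algebra
    also have "\<dots> = \<pi> (t \<otimes>\<^bsub>P\<^esub> v)" using cl wv(3) by simp
    finally obtain w' v' where wv': "w' \<in> W" "v' \<in> Idl\<^bsub>P\<^esub> (set (take k ys))"
      "\<pi> (w' \<otimes>\<^bsub>P\<^esub> (w \<otimes>\<^bsub>P\<^esub> u)) = \<pi> v'"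
      using nzd[OF k, of "w \<otimes>\<^bsub>P\<^esub> u" "t \<otimes>\<^bsub>P\<^esub> v"] cl tu(2)
        ideal.I_l_closed[OF R.genideal_ideal[OF tk] wv(2) cl(2)] by auto
    have w'c: "w' \<in> carrier P" using wv'(1) W(1) by auto
    have "\<pi> (w' \<otimes>\<^bsub>P\<^esub> w \<otimes>\<^bsub>P\<^esub> t) \<otimes>\<^bsub>C\<^esub> c = \<pi> w' \<otimes>\<^bsub>C\<^esub> (\<pi> w \<otimes>\<^bsub>C\<^esub> (\<pi> t \<otimes>\<^bsub>C\<^esub> c))"
      using w'c cl c by (simp add: S.m_assoc)
    also have "\<dots> = \<pi> v'" using wv'(3) w'c cl tu by simp
    finally have "c \<in> Idl\<^bsub>C\<^esub> (\<pi> ` set (take k ys))"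
      using mem[OF tk c, of k] wv' W(3) wv(1) tu(1) by blast
    then show "c \<in> Idl\<^bsub>C\<^esub> (set (take k (map \<pi> ys)))" by (simp add: take_map)
  next
    have "\<one>\<^bsub>C\<^esub> \<notin> Idl\<^bsub>C\<^esub> (\<pi> ` set ys)"
    proof
      assume "\<one>\<^bsub>C\<^esub> \<in> Idl\<^bsub>C\<^esub> (\<pi> ` set ys)"
      then obtain w v where "w \<in> W" "v \<in> Idl\<^bsub>P\<^esub> (set ys)" "\<pi> w \<otimes>\<^bsub>C\<^esub> \<one>\<^bsub>C\<^esub> = \<pi> v"
        using mem[OF ys S.one_closed] by blast
      then show False using proper W(1) by auto
    qed
    then show "Idl\<^bsub>C\<^esub> (set (map \<pi> ys)) \<noteq> carrier C" using S.one_closed by auto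
  qed
qed

section \<open>Rings of fractions\<close>

locale multiplicative_subset = cring R for R (structure) +
  fixes W
  assumes W_sub: "W \<subseteq> carrier R" and W_one: "\<one> \<in> W"
    and W_mult: "s \<in> W \<Longrightarrow> t \<in> W \<Longrightarrow> s \<otimes> t \<in> W"
begin

lemma W_carrier [simp, intro]: "s \<in> W \<Longrightarrow> s \<in> carrier R"
  using W_sub by blast

text \<open>
  The class of the fraction \<open>u/s\<close>.  The factor \<open>w\<close> makes the relation transitive when \<open>W\<close> contains
  zero divisors, which is the situation of interest: elements killed by \<open>W\<close> have to become \<open>0\<close>.
\<close>
definition fraction :: "'a \<Rightarrow> 'a \<Rightarrow> ('a \<times> 'a) set" where
  "fraction u s = {(v, t). v \<in> carrier R \<and> t \<in> W \<and> (\<exists>w \<in> W. w \<otimes> (t \<otimes> u) = w \<otimes> (s \<otimes> v))}"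

definition fraction_ring :: "('a \<times> 'a) set ring" where
  "fraction_ring = \<lparr>carrier = {fraction u s | u s. u \<in> carrier R \<and> s \<in> W},
     monoid.mult = (\<lambda>A B. \<Union>(u, s) \<in> A. \<Union>(v, t) \<in> B. fraction (u \<otimes> v) (s \<otimes> t)),
     one = fraction \<one> \<one>, ring.zero = fraction \<zero> \<one>,
     ring.add = (\<lambda>A B. \<Union>(u, s) \<in> A. \<Union>(v, t) \<in> B. fraction (t \<otimes> u \<oplus> s \<otimes> v) (s \<otimes> t))\<rparr>"

lemma fraction_self: "u \<in> carrier R \<Longrightarrow> s \<in> W \<Longrightarrow> (u, s) \<in> fraction u s"
  using W_one by (auto simp: fraction_def)

lemma fraction_eqI:
  assumes "u \<in> carrier R" "s \<in> W" "v \<in> carrier R" "t \<in> W"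
    and "w \<in> W" "w \<otimes> (t \<otimes> u) = w \<otimes> (s \<otimes> v)"
  shows "fraction u s = fraction v t"
proof -
  have sub: "fraction u s \<subseteq> fraction v t"
    if c: "u \<in> carrier R" "s \<in> W" "v \<in> carrier R" "t \<in> W" "w \<in> W"
      and e: "w \<otimes> (t \<otimes> u) = w \<otimes> (s \<otimes> v)" for u s v t w
  proof (clarsimp simp: fraction_def)
    fix x r w' assume x: "x \<in> carrier R" "r \<in> W" "w' \<in> W"
      and e': "w' \<otimes> (r \<otimes> u) = w' \<otimes> (s \<otimes> x)"
    have cl: "w \<in> carrier R" "w' \<in> carrier R" "s \<in> carrier R" "t \<in> carrier R" "r \<in> carrier R"
      using c x by auto
    have "(w \<otimes> w' \<otimes> s) \<otimes> (r \<otimes> v) = (w \<otimes> (s \<otimes> v)) \<otimes> (w' \<otimes> r)" using cl c x by algebra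
    also have "\<dots> = (w \<otimes> (t \<otimes> u)) \<otimes> (w' \<otimes> r)" using e by simp
    also have "\<dots> = (w' \<otimes> (r \<otimes> u)) \<otimes> (w \<otimes> t)" using cl c x by algebra
    also have "\<dots> = (w' \<otimes> (s \<otimes> x)) \<otimes> (w \<otimes> t)" using e' by simp
    also have "\<dots> = (w \<otimes> w' \<otimes> s) \<otimes> (t \<otimes> x)" using cl c x by algebra
    finally show "\<exists>w \<in> W. w \<otimes> (r \<otimes> v) = w \<otimes> (t \<otimes> x)"
      using W_mult c x by (intro bexI[of _ "w \<otimes> w' \<otimes> s"]) auto
  qed
  show ?thesis using sub[OF assms] sub[OF assms(3,4,1,2,5)] assms(6) by auto
qed

lemma fraction_eq_iff:
  assumes "u \<in> carrier R" "s \<in> W" "v \<in> carrier R" "t \<in> W"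
  shows "fraction u s = fraction v t \<longleftrightarrow> (\<exists>w \<in> W. w \<otimes> (t \<otimes> u) = w \<otimes> (s \<otimes> v))"
proof
  assume "fraction u s = fraction v t"
  then have "(v, t) \<in> fraction u s" using fraction_self[OF assms(3,4)] by simp
  then show "\<exists>w \<in> W. w \<otimes> (t \<otimes> u) = w \<otimes> (s \<otimes> v)" by (simp add: fraction_def)
qed (use fraction_eqI[OF assms] in blast)

lemma mem_fractionD:
  assumes "(v, t) \<in> fraction u s" "u \<in> carrier R" "s \<in> W"
  shows "v \<in> carrier R" "t \<in> W" "fraction v t = fraction u s"
proof -
  obtain w where w: "v \<in> carrier R" "t \<in> W" "w \<in> W" "w \<otimes> (t \<otimes> u) = w \<otimes> (s \<otimes> v)"
    using assms(1) unfolding fraction_def by blast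
  then show "v \<in> carrier R" "t \<in> W" by auto
  show "fraction v t = fraction u s" using fraction_eqI[OF assms(2,3) w] by simp
qed

lemma fraction_carrier [simp, intro]:
  "u \<in> carrier R \<Longrightarrow> s \<in> W \<Longrightarrow> fraction u s \<in> carrier fraction_ring"
  by (auto simp: fraction_ring_def)

lemma fraction_ring_cases:
  assumes "A \<in> carrier fraction_ring"
  obtains u s where "u \<in> carrier R" "s \<in> W" "A = fraction u s"
  using assms by (auto simp: fraction_ring_def)

text \<open>
  The operations of \<open>fraction_ring\<close> are unions over all representatives; this evaluates them on one
  pair of representatives, once independence of the choice is known.
\<close>
lemma UN_fraction_const:
  assumes "u \<in> carrier R" "s \<in> W" "v \<in> carrier R" "t \<in> W"
    and "\<And>u' s' v' t'. (u', s') \<in> fraction u s \<Longrightarrow> (v', t') \<in> fraction v t \<Longrightarrow> f u' s' v' t' = f u s v t"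
  shows "(\<Union>(u', s') \<in> fraction u s. \<Union>(v', t') \<in> fraction v t. f u' s' v' t') = f u s v t"
proof -
  have "(\<Union>(u', s') \<in> fraction u s. \<Union>(v', t') \<in> fraction v t. f u' s' v' t')
      = (\<Union>p \<in> fraction u s. \<Union>q \<in> fraction v t. f u s v t)"
    using assms(5) by (intro SUP_cong refl) auto
  also have "\<dots> = f u s v t"
    using fraction_self[OF assms(1,2)] fraction_self[OF assms(3,4)] by auto
  finally show ?thesis .
qed

lemma fraction_mult:
  assumes c: "u \<in> carrier R" "s \<in> W" "v \<in> carrier R" "t \<in> W"
  shows "fraction u s \<otimes>\<^bsub>fraction_ring\<^esub> fraction v t = fraction (u \<otimes> v) (s \<otimes> t)"
proof -
  have "fraction (u' \<otimes> v') (s' \<otimes> t') = fraction (u \<otimes> v) (s \<otimes> t)"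
    if m: "(u', s') \<in> fraction u s" "(v', t') \<in> fraction v t" for u' s' v' t'
  proof -
    obtain w w' where w: "w \<in> W" "w \<otimes> (s' \<otimes> u) = w \<otimes> (s \<otimes> u')"
      "w' \<in> W" "w' \<otimes> (t' \<otimes> v) = w' \<otimes> (t \<otimes> v')"
      using m unfolding fraction_def by auto
    have c': "u' \<in> carrier R" "s' \<in> W" "v' \<in> carrier R" "t' \<in> W"
      using mem_fractionD[OF m(1) c(1,2)] mem_fractionD[OF m(2) c(3,4)] by auto
    have cl: "w \<in> carrier R" "w' \<in> carrier R" "s \<in> carrier R" "t \<in> carrier R"
      "s' \<in> carrier R" "t' \<in> carrier R" using w c c' by auto
    have "(w \<otimes> w') \<otimes> ((s \<otimes> t) \<otimes> (u' \<otimes> v')) = (w \<otimes> (s \<otimes> u')) \<otimes> (w' \<otimes> (t \<otimes> v'))"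
      using cl c c' by algebra
    also have "\<dots> = (w \<otimes> (s' \<otimes> u)) \<otimes> (w' \<otimes> (t' \<otimes> v))" using w by simp
    also have "\<dots> = (w \<otimes> w') \<otimes> ((s' \<otimes> t') \<otimes> (u \<otimes> v))" using cl c c' by algebra
    finally show ?thesis
      using c c' w W_mult by (intro fraction_eqI[where w = "w \<otimes> w'"]) auto
  qed
  then show ?thesis
    using UN_fraction_const[OF c, of "\<lambda>u s v t. fraction (u \<otimes> v) (s \<otimes> t)"]
    by (simp add: fraction_ring_def)
qed

lemma fraction_add:
  assumes c: "u \<in> carrier R" "s \<in> W" "v \<in> carrier R" "t \<in> W"
  shows "fraction u s \<oplus>\<^bsub>fraction_ring\<^esub> fraction v t = fraction (t \<otimes> u \<oplus> s \<otimes> v) (s \<otimes> t)"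
proof -
  have "fraction (t' \<otimes> u' \<oplus> s' \<otimes> v') (s' \<otimes> t') = fraction (t \<otimes> u \<oplus> s \<otimes> v) (s \<otimes> t)"
    if m: "(u', s') \<in> fraction u s" "(v', t') \<in> fraction v t" for u' s' v' t'
  proof -
    obtain w w' where w: "w \<in> W" "w \<otimes> (s' \<otimes> u) = w \<otimes> (s \<otimes> u')"
      "w' \<in> W" "w' \<otimes> (t' \<otimes> v) = w' \<otimes> (t \<otimes> v')"
      using m unfolding fraction_def by auto
    have c': "u' \<in> carrier R" "s' \<in> W" "v' \<in> carrier R" "t' \<in> W"
      using mem_fractionD[OF m(1) c(1,2)] mem_fractionD[OF m(2) c(3,4)] by auto
    have cl: "w \<in> carrier R" "w' \<in> carrier R" "s \<in> carrier R" "t \<in> carrier R"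
      "s' \<in> carrier R" "t' \<in> carrier R" using w c c' by auto
    have "(w \<otimes> w') \<otimes> ((s \<otimes> t) \<otimes> (t' \<otimes> u' \<oplus> s' \<otimes> v'))
        = (w \<otimes> (s \<otimes> u')) \<otimes> (w' \<otimes> t \<otimes> t') \<oplus> (w' \<otimes> (t \<otimes> v')) \<otimes> (w \<otimes> s \<otimes> s')"
      using cl c c' by algebra
    also have "\<dots> = (w \<otimes> (s' \<otimes> u)) \<otimes> (w' \<otimes> t \<otimes> t') \<oplus> (w' \<otimes> (t' \<otimes> v)) \<otimes> (w \<otimes> s \<otimes> s')"
      using w by simp
    also have "\<dots> = (w \<otimes> w') \<otimes> ((s' \<otimes> t') \<otimes> (t \<otimes> u \<oplus> s \<otimes> v))" using cl c c' by algebra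
    finally show ?thesis
      using c c' w W_mult by (intro fraction_eqI[where w = "w \<otimes> w'"]) auto
  qed
  then show ?thesis
    using UN_fraction_const[OF c, of "\<lambda>u s v t. fraction (t \<otimes> u \<oplus> s \<otimes> v) (s \<otimes> t)"]
    by (simp add: fraction_ring_def)
qed

lemma fraction_ring_one: "\<one>\<^bsub>fraction_ring\<^esub> = fraction \<one> \<one>"
  and fraction_ring_zero: "\<zero>\<^bsub>fraction_ring\<^esub> = fraction \<zero> \<one>"
  by (simp_all add: fraction_ring_def)

lemma cring_fraction_ring: "cring fraction_ring"
proof -
  have eq: "fraction u s = fraction v t"
    if "u \<in> carrier R" "s \<in> W" "v \<in> carrier R" "t \<in> W" "t \<otimes> u = s \<otimes> v" for u s v t
    using that W_one by (intro fraction_eqI[where w = \<one>]) auto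
  note [simp] = fraction_mult fraction_add fraction_ring_one fraction_ring_zero W_one W_mult
  show ?thesis
  proof (intro cringI abelian_groupI comm_monoidI)
    fix A B assume "A \<in> carrier fraction_ring" "B \<in> carrier fraction_ring"
    then obtain u s v t where c: "u \<in> carrier R" "s \<in> W" "A = fraction u s"
      "v \<in> carrier R" "t \<in> W" "B = fraction v t"
      by (auto elim!: fraction_ring_cases)
    then have cl: "s \<in> carrier R" "t \<in> carrier R" by auto
    show "A \<oplus>\<^bsub>fraction_ring\<^esub> B \<in> carrier fraction_ring"
      "A \<otimes>\<^bsub>fraction_ring\<^esub> B \<in> carrier fraction_ring"
      using c cl by simp_all
    show "A \<oplus>\<^bsub>fraction_ring\<^esub> B = B \<oplus>\<^bsub>fraction_ring\<^esub> A"
      using c cl by (simp add: a_comm m_comm)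
    show "A \<otimes>\<^bsub>fraction_ring\<^esub> B = B \<otimes>\<^bsub>fraction_ring\<^esub> A"
      using c cl by (simp add: m_comm)
  next
    fix A B C
    assume "A \<in> carrier fraction_ring" "B \<in> carrier fraction_ring" "C \<in> carrier fraction_ring"
    then obtain u s v t x r where c: "u \<in> carrier R" "s \<in> W" "A = fraction u s"
      "v \<in> carrier R" "t \<in> W" "B = fraction v t" "x \<in> carrier R" "r \<in> W" "C = fraction x r"
      by (auto elim!: fraction_ring_cases)
    then have cl: "s \<in> carrier R" "t \<in> carrier R" "r \<in> carrier R" by auto
    have "r \<otimes> (t \<otimes> u \<oplus> s \<otimes> v) \<oplus> s \<otimes> t \<otimes> x = t \<otimes> r \<otimes> u \<oplus> s \<otimes> (r \<otimes> v \<oplus> t \<otimes> x)"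
      using c cl by algebra
    then show "A \<oplus>\<^bsub>fraction_ring\<^esub> B \<oplus>\<^bsub>fraction_ring\<^esub> C
        = A \<oplus>\<^bsub>fraction_ring\<^esub> (B \<oplus>\<^bsub>fraction_ring\<^esub> C)"
      using c cl by (simp add: m_assoc)
    show "A \<otimes>\<^bsub>fraction_ring\<^esub> B \<otimes>\<^bsub>fraction_ring\<^esub> C
        = A \<otimes>\<^bsub>fraction_ring\<^esub> (B \<otimes>\<^bsub>fraction_ring\<^esub> C)"
      using c cl by (simp add: m_assoc)
    have "(s \<otimes> r \<otimes> (t \<otimes> r)) \<otimes> ((t \<otimes> u \<oplus> s \<otimes> v) \<otimes> x)
        = (s \<otimes> t \<otimes> r) \<otimes> (t \<otimes> r \<otimes> (u \<otimes> x) \<oplus> s \<otimes> r \<otimes> (v \<otimes> x))"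
      using c cl by algebra
    then show "(A \<oplus>\<^bsub>fraction_ring\<^esub> B) \<otimes>\<^bsub>fraction_ring\<^esub> C
        = A \<otimes>\<^bsub>fraction_ring\<^esub> C \<oplus>\<^bsub>fraction_ring\<^esub> B \<otimes>\<^bsub>fraction_ring\<^esub> C"
      using c cl by (simp, intro eq) auto
  next
    fix A assume "A \<in> carrier fraction_ring"
    then obtain u s where c: "u \<in> carrier R" "s \<in> W" "A = fraction u s"
      by (auto elim!: fraction_ring_cases)
    then have cl: "s \<in> carrier R" by auto
    show "\<one>\<^bsub>fraction_ring\<^esub> \<otimes>\<^bsub>fraction_ring\<^esub> A = A"
      "\<zero>\<^bsub>fraction_ring\<^esub> \<oplus>\<^bsub>fraction_ring\<^esub> A = A"
      using c cl by simp_all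
    have "s \<otimes> (\<ominus> u) \<oplus> s \<otimes> u = \<zero>" using c cl by algebra
    moreover have "fraction \<zero> (s \<otimes> s) = fraction \<zero> \<one>" using c cl by (intro eq) auto
    ultimately have "fraction (\<ominus> u) s \<oplus>\<^bsub>fraction_ring\<^esub> A = \<zero>\<^bsub>fraction_ring\<^esub>"
      using c by simp
    then show "\<exists>B \<in> carrier fraction_ring. B \<oplus>\<^bsub>fraction_ring\<^esub> A = \<zero>\<^bsub>fraction_ring\<^esub>"
      using c by blast
  qed simp_all
qed

lemma ring_hom_fraction_ring: "ring_hom_cring R fraction_ring (\<lambda>u. fraction u \<one>)"
proof (intro ring_hom_cring.intro ring_hom_cring_axioms.intro ring_hom_memI)
  show "cring R" by (rule is_cring)
qed (auto simp: cring_fraction_ring fraction_mult fraction_add fraction_ring_one W_one)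

text \<open>
  Localization preserves injectivity of multiplication by each member of the sequence, so only
  properness can fail, and it fails exactly when the ideal meets \<open>W\<close>.
\<close>
lemma regular_sequence_fraction_ring:
  assumes reg: "regular_sequence R ys" and disj: "W \<inter> Idl (set ys) = {}"
  shows "regular_sequence fraction_ring (map (\<lambda>u. fraction u \<one>) ys)"
proof (rule regular_sequence_fractions[OF ring_hom_fraction_ring W_sub W_one W_mult])
  show ys: "set ys \<subseteq> carrier R" using reg by (simp add: regular_sequence_def)
  have tk: "set (take k ys) \<subseteq> carrier R" for k using ys set_take_subset by fast
  have eq: "fraction u \<one> = fraction v \<one> \<longleftrightarrow> (\<exists>w \<in> W. w \<otimes> u = w \<otimes> v)"
    if "u \<in> carrier R" "v \<in> carrier R" for u v
    using that W_one by (auto simp: fraction_eq_iff)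
  show "\<exists>v \<in> carrier fraction_ring. fraction w \<one> \<otimes>\<^bsub>fraction_ring\<^esub> v = \<one>\<^bsub>fraction_ring\<^esub>"
    if w: "w \<in> W" for w
  proof (intro bexI[of _ "fraction \<one> w"])
    have "fraction w \<one> \<otimes>\<^bsub>fraction_ring\<^esub> fraction \<one> w = fraction w w"
      using w W_one by (simp add: fraction_mult)
    also have "\<dots> = fraction \<one> \<one>" by (rule fraction_eqI[where w = \<one>]) (use w W_one in auto)
    finally show "fraction w \<one> \<otimes>\<^bsub>fraction_ring\<^esub> fraction \<one> w = \<one>\<^bsub>fraction_ring\<^esub>"
      by (simp add: fraction_ring_one)
  qed (use w in auto)
  show "\<exists>w \<in> W. \<exists>u \<in> carrier R. fraction w \<one> \<otimes>\<^bsub>fraction_ring\<^esub> c = fraction u \<one>"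
    if C: "c \<in> carrier fraction_ring" for c
  proof -
    obtain u s where c: "u \<in> carrier R" "s \<in> W" "c = fraction u s"
      using fraction_ring_cases[OF C] by blast
    then have "fraction s \<one> \<otimes>\<^bsub>fraction_ring\<^esub> c = fraction (s \<otimes> u) s"
      using W_one by (simp add: fraction_mult)
    also have "\<dots> = fraction u \<one>"
      by (rule fraction_eqI[where w = \<one>]) (use c W_one in auto)
    finally have "fraction s \<one> \<otimes>\<^bsub>fraction_ring\<^esub> c = fraction u \<one>" .
    then show ?thesis using c by blast
  qed
  show "\<exists>w \<in> W. \<exists>v' \<in> Idl (set (take k ys)). fraction (w \<otimes> u) \<one> = fraction v' \<one>"
    if k: "k < length ys" and u: "u \<in> carrier R" and v: "v \<in> Idl (set (take k ys))"
      and e: "fraction (ys ! k \<otimes> u) \<one> = fraction v \<one>" for k u v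
  proof -
    interpret I: ideal "Idl (set (take k ys))" R by (rule genideal_ideal[OF tk])
    have yk: "ys ! k \<in> carrier R" using ys k by auto
    obtain w where w: "w \<in> W" "w \<otimes> (ys ! k \<otimes> u) = w \<otimes> v"
      using e eq yk u I.Icarr[OF v] by auto
    then have "ys ! k \<otimes> (w \<otimes> u) \<in> Idl (set (take k ys))"
      using I.I_l_closed[OF v, of w] yk u m_lcomm[of "ys ! k" w u] by auto
    then have "w \<otimes> u \<in> Idl (set (take k ys))"
      using reg k u w(1) unfolding regular_sequence_def by auto
    then show ?thesis using w(1) by blast
  qed
  show "fraction w \<one> \<noteq> fraction v \<one>" if w: "w \<in> W" and v: "v \<in> Idl (set ys)" for w v
  proof
    interpret I: ideal "Idl (set ys)" R by (rule genideal_ideal[OF ys])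
    assume "fraction w \<one> = fraction v \<one>"
    then obtain w' where w': "w' \<in> W" "w' \<otimes> w = w' \<otimes> v" using eq w I.Icarr[OF v] by auto
    have "w' \<otimes> w \<in> W" using W_mult[OF w'(1) w] .
    moreover have "w' \<otimes> w \<in> Idl (set ys)" unfolding w'(2) using I.I_l_closed[OF v] w'(1) by auto
    ultimately have "w' \<otimes> w \<in> W \<inter> Idl (set ys)" by blast
    then show False using disj by blast
  qed
qed

end

text \<open>
  For an arbitrary ideal \<open>N\<close> a regular sequence need not stay regular modulo \<open>N\<close>; the hypotheses spell
  out the conditions in terms of \<open>P\<close>, with \<open>n\<close> and \<open>n'\<close> as error terms in \<open>N\<close>.
\<close>
lemma regular_sequence_Quot:
  assumes P: "cring P" and N: "ideal N P" and ys: "set ys \<subseteq> carrier P"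
    and nzd: "\<And>k u n. k < length ys \<Longrightarrow> u \<in> carrier P \<Longrightarrow> n \<in> N \<Longrightarrow>
      ys ! k \<otimes>\<^bsub>P\<^esub> u \<ominus>\<^bsub>P\<^esub> n \<in> Idl\<^bsub>P\<^esub> (set (take k ys)) \<Longrightarrow>
      \<exists>n' \<in> N. u \<ominus>\<^bsub>P\<^esub> n' \<in> Idl\<^bsub>P\<^esub> (set (take k ys))"
    and proper: "\<And>n. n \<in> N \<Longrightarrow> \<one>\<^bsub>P\<^esub> \<ominus>\<^bsub>P\<^esub> n \<notin> Idl\<^bsub>P\<^esub> (set ys)"
  shows "regular_sequence (P Quot N) (map (\<lambda>u. N +>\<^bsub>P\<^esub> u) ys)"
proof -
  interpret cring P by fact
  interpret N: ideal N P by fact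
  have eq: "N +>\<^bsub>P\<^esub> u = N +>\<^bsub>P\<^esub> v \<longleftrightarrow> u \<ominus>\<^bsub>P\<^esub> v \<in> N"
    if "u \<in> carrier P" "v \<in> carrier P" for u v
    using quotient_eq_iff_same_a_r_cos[OF N that] by simp
  interpret \<pi>: ring_hom_cring P "P Quot N" "(+>\<^bsub>P\<^esub>) N" by (rule N.rcos_ring_hom_cring[OF P])
  have tk: "set (take k ys) \<subseteq> carrier P" for k using ys set_take_subset by fast
  show ?thesis
  proof (rule regular_sequence_fractions[where W = "{\<one>\<^bsub>P\<^esub>}" and P = P])
    show "ring_hom_cring P (P Quot N) ((+>\<^bsub>P\<^esub>) N)" by (rule \<pi>.ring_hom_cring_axioms)
    show "set ys \<subseteq> carrier P" by fact
    show "\<exists>w \<in> {\<one>\<^bsub>P\<^esub>}. \<exists>u \<in> carrier P. (N +>\<^bsub>P\<^esub> w) \<otimes>\<^bsub>P Quot N\<^esub> c = N +>\<^bsub>P\<^esub> u"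
      if "c \<in> carrier (P Quot N)" for c
    proof -
      obtain u where "u \<in> carrier P" "c = N +>\<^bsub>P\<^esub> u"
        using \<open>c \<in> carrier (P Quot N)\<close> unfolding FactRing_def A_RCOSETS_def' by auto
      then show ?thesis using that by auto
    qed
    show "\<exists>v \<in> carrier (P Quot N). (N +>\<^bsub>P\<^esub> w) \<otimes>\<^bsub>P Quot N\<^esub> v = \<one>\<^bsub>P Quot N\<^esub>" if "w \<in> {\<one>\<^bsub>P\<^esub>}" for w
      using that by (intro bexI[of _ "\<one>\<^bsub>P Quot N\<^esub>"]) auto
    show "\<exists>w \<in> {\<one>\<^bsub>P\<^esub>}. \<exists>v' \<in> Idl\<^bsub>P\<^esub> (set (take k ys)). N +>\<^bsub>P\<^esub> (w \<otimes>\<^bsub>P\<^esub> u) = N +>\<^bsub>P\<^esub> v'"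
      if k: "k < length ys" and u: "u \<in> carrier P" and v: "v \<in> Idl\<^bsub>P\<^esub> (set (take k ys))"
        and e: "N +>\<^bsub>P\<^esub> (ys ! k \<otimes>\<^bsub>P\<^esub> u) = N +>\<^bsub>P\<^esub> v" for k u v
    proof -
      interpret I: ideal "Idl\<^bsub>P\<^esub> (set (take k ys))" P by (rule genideal_ideal[OF tk])
      have yk: "ys ! k \<in> carrier P" using ys k by auto
      have vc: "v \<in> carrier P" by (rule I.Icarr[OF v])
      let ?n = "ys ! k \<otimes>\<^bsub>P\<^esub> u \<ominus>\<^bsub>P\<^esub> v"
      have n: "?n \<in> N" using e eq[OF m_closed[OF yk u] vc] by blast
      have "ys ! k \<otimes>\<^bsub>P\<^esub> u \<ominus>\<^bsub>P\<^esub> ?n = v" using yk u vc by algebra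
      then obtain n' where n': "n' \<in> N" "u \<ominus>\<^bsub>P\<^esub> n' \<in> Idl\<^bsub>P\<^esub> (set (take k ys))"
        using nzd[OF k u n] v by auto
      have "u \<ominus>\<^bsub>P\<^esub> (u \<ominus>\<^bsub>P\<^esub> n') = n'" using u N.Icarr[OF n'(1)] by algebra
      then have "N +>\<^bsub>P\<^esub> u = N +>\<^bsub>P\<^esub> (u \<ominus>\<^bsub>P\<^esub> n')"
        using eq[of u "u \<ominus>\<^bsub>P\<^esub> n'"] u N.Icarr[OF n'(1)] n'(1) by simp
      then show ?thesis using n'(2) u by auto
    qed
    show "N +>\<^bsub>P\<^esub> w \<noteq> N +>\<^bsub>P\<^esub> v" if "w \<in> {\<one>\<^bsub>P\<^esub>}" and v: "v \<in> Idl\<^bsub>P\<^esub> (set ys)" for w v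
    proof
      assume e: "N +>\<^bsub>P\<^esub> w = N +>\<^bsub>P\<^esub> v"
      have vc: "v \<in> carrier P" by (rule ideal.Icarr[OF genideal_ideal[OF ys] v])
      have "\<one>\<^bsub>P\<^esub> \<ominus>\<^bsub>P\<^esub> (\<one>\<^bsub>P\<^esub> \<ominus>\<^bsub>P\<^esub> v) = v" using vc one_closed by algebra
      then show False using proper[of "\<one>\<^bsub>P\<^esub> \<ominus>\<^bsub>P\<^esub> v"] e eq[of "\<one>\<^bsub>P\<^esub>" v] that vc by auto
    qed
  qed auto
qed

section \<open>The ideal of null sequences\<close>

text \<open>
  The residue class ring modulo these sequences takes the place of a completion.  The exponents
  \<open>e - k\<close> grow with \<open>e\<close>, and since \<open>k\<close> may depend on \<open>u\<close>, the ideal can absorb the loss of one in the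
  exponent at each division by a member of \<open>ys\<close>.
\<close>
definition null_sequences :: "('b, 'n) ring_scheme \<Rightarrow> (nat \<Rightarrow> 'b) list \<Rightarrow> (nat \<Rightarrow> 'b) set" where
  "null_sequences B ys = {u \<in> carrier (sequence_ring B).
     \<exists>k. \<forall>e\<ge>k. u e \<in> Idl\<^bsub>B\<^esub> ((\<lambda>x. x [^]\<^bsub>B\<^esub> (e - k)) ` (\<lambda>y. y e) ` set ys)}"

lemma (in cring) null_sequence_later:
  assumes ys: "set ys \<subseteq> carrier (sequence_ring R)" and k: "k \<le> k'"
    and u: "\<forall>e\<ge>k. u e \<in> Idl ((\<lambda>x. x [^] (e - k)) ` (\<lambda>y. y e) ` set ys)"
  shows "\<forall>e\<ge>k'. u e \<in> Idl ((\<lambda>x. x [^] (e - k')) ` (\<lambda>y. y e) ` set ys)"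
proof (intro allI impI)
  fix e assume e: "k' \<le> e"
  have "(\<lambda>y. y e) ` set ys \<subseteq> carrier R" using ys by auto
  moreover have "e - k' \<le> e - k" using k by simp
  ultimately have "Idl ((\<lambda>x. x [^] (e - k)) ` (\<lambda>y. y e) ` set ys)
      \<subseteq> Idl ((\<lambda>x. x [^] (e - k')) ` (\<lambda>y. y e) ` set ys)"
    by (rule Idl_powers_antimono)
  then show "u e \<in> Idl ((\<lambda>x. x [^] (e - k')) ` (\<lambda>y. y e) ` set ys)" using u e k by fastforce
qed

lemma ideal_null_sequences:
  assumes B: "cring B" and ys: "set ys \<subseteq> carrier (sequence_ring B)"
  shows "ideal (null_sequences B ys) (sequence_ring B)"
proof -
  interpret B: cring B by fact
  interpret P: cring "sequence_ring B" by (rule cring_sequence_ring) fact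
  let ?I = "\<lambda>e k. Idl\<^bsub>B\<^esub> ((\<lambda>x. x [^]\<^bsub>B\<^esub> (e - k)) ` (\<lambda>y. y e) ` set ys)"
  have id: "ideal (?I e k) B" for e k :: nat
    using ys by (intro B.genideal_ideal) auto
  note cl = additive_subgroup.a_closed[OF ideal.axioms(1)[OF id]]
    additive_subgroup.a_inv_closed[OF ideal.axioms(1)[OF id]]
    additive_subgroup.zero_closed[OF ideal.axioms(1)[OF id]]
  show ?thesis
  proof (rule idealI[OF P.ring_axioms])
    show "subgroup (null_sequences B ys) (add_monoid (sequence_ring B))"
    proof (rule P.add.subgroupI)
      show "null_sequences B ys \<subseteq> carrier (sequence_ring B)" by (auto simp: null_sequences_def)
      have "\<zero>\<^bsub>sequence_ring B\<^esub> \<in> null_sequences B ys"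
        using cl(3) by (auto simp: null_sequences_def)
      then show "null_sequences B ys \<noteq> {}" by blast
    next
      fix u assume u: "u \<in> null_sequences B ys"
      then have "\<ominus>\<^bsub>sequence_ring B\<^esub> u = (\<lambda>e. \<ominus>\<^bsub>B\<^esub> u e)"
        by (intro sequence_ring_a_inv B) (simp add: null_sequences_def)
      moreover obtain k where "u \<in> carrier (sequence_ring B)" "\<forall>e\<ge>k. u e \<in> ?I e k"
        using u unfolding null_sequences_def by blast
      ultimately show "\<ominus>\<^bsub>sequence_ring B\<^esub> u \<in> null_sequences B ys"
        using cl(2) unfolding null_sequences_def by (auto intro!: exI[of _ k])
    next
      fix u v assume "u \<in> null_sequences B ys" "v \<in> null_sequences B ys"
      then obtain k l where c: "u \<in> carrier (sequence_ring B)" "v \<in> carrier (sequence_ring B)"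
        and uv: "\<forall>e\<ge>k. u e \<in> ?I e k" "\<forall>e\<ge>l. v e \<in> ?I e l"
        unfolding null_sequences_def by blast
      have "\<forall>e\<ge>max k l. u e \<in> ?I e (max k l)" "\<forall>e\<ge>max k l. v e \<in> ?I e (max k l)"
        using B.null_sequence_later[OF ys _ uv(1)] B.null_sequence_later[OF ys _ uv(2)] by simp_all
      then have "\<forall>e\<ge>max k l. u e \<oplus>\<^bsub>B\<^esub> v e \<in> ?I e (max k l)" using cl(1) by blast
      then show "u \<oplus>\<^bsub>sequence_ring B\<^esub> v \<in> null_sequences B ys"
        unfolding null_sequences_def using c
        by (intro CollectI conjI exI[of _ "max k l"]) simp_all
    qed
  next
    fix u v assume "u \<in> null_sequences B ys" and v: "v \<in> carrier (sequence_ring B)"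
    then obtain k where c: "u \<in> carrier (sequence_ring B)" and u: "\<forall>e\<ge>k. u e \<in> ?I e k"
      unfolding null_sequences_def by blast
    show "v \<otimes>\<^bsub>sequence_ring B\<^esub> u \<in> null_sequences B ys"
      using c v u ideal.I_l_closed[OF id] unfolding null_sequences_def
      by (auto intro!: exI[of _ k])
    then show "u \<otimes>\<^bsub>sequence_ring B\<^esub> v \<in> null_sequences B ys"
      using P.m_comm[OF c v] by simp
  qed
qed

text \<open>
  The estimate \<open>regular_sequence_approximate\<close> is applied in each entry.  If \<open>l\<close> is the bound
  for the error \<open>n\<close>, then \<open>l + 1\<close> will do for the new error, whose entries up to \<open>l\<close> may thus be
  arbitrary; taking \<open>u e\<close> itself there makes the difference vanish.
\<close>
lemma regular_sequence_Quot_null_sequences: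
  assumes B: "cring B" and ys: "set ys \<subseteq> carrier (sequence_ring B)"
    and reg: "\<And>e. regular_sequence B (map (\<lambda>y. y e) ys)"
  shows "regular_sequence (sequence_ring B Quot null_sequences B ys)
    (map (\<lambda>u. null_sequences B ys +>\<^bsub>sequence_ring B\<^esub> u) ys)"
proof (rule regular_sequence_Quot[OF cring_sequence_ring[OF B] ideal_null_sequences[OF B ys] ys])
  interpret B: cring B by fact
  interpret P: cring "sequence_ring B" by (rule cring_sequence_ring) fact
  let ?I = "\<lambda>e m. Idl\<^bsub>B\<^esub> ((\<lambda>x. x [^]\<^bsub>B\<^esub> (m::nat)) ` (\<lambda>y. y e) ` set ys)"
  have ysB: "(\<lambda>y. y e) ` set ys \<subseteq> carrier B" for e using ys by auto
  have IB: "(\<lambda>x. x [^]\<^bsub>B\<^esub> (m::nat)) ` (\<lambda>y. y e) ` set ys \<subseteq> carrier B" for e m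
    using ysB[of e] by auto
  have tk: "set (take k ys) \<subseteq> carrier (sequence_ring B)" for k using ys set_take_subset by fast
  fix n assume "n \<in> null_sequences B ys"
  then obtain l where nc: "n \<in> carrier (sequence_ring B)" and n: "\<forall>e\<ge>l. n e \<in> ?I e (e - l)"
    unfolding null_sequences_def by blast
  have nB: "n e \<in> carrier B" for e using nc by simp
  {
    fix k u assume k: "k < length ys" and u: "u \<in> carrier (sequence_ring B)"
      and m: "ys ! k \<otimes>\<^bsub>sequence_ring B\<^esub> u \<ominus>\<^bsub>sequence_ring B\<^esub> n
        \<in> Idl\<^bsub>sequence_ring B\<^esub> (set (take k ys))"
    have yk: "ys ! k \<in> carrier (sequence_ring B)" using k ys nth_mem by blast
    have uB: "u e \<in> carrier B" for e using u by simp
    let ?T = "\<lambda>e. Idl\<^bsub>B\<^esub> ((\<lambda>y. y e) ` set (take k ys))"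
    have T: "ideal (?T e) B" for e using tk[of k] by (intro B.genideal_ideal) auto
    have me: "(ys ! k) e \<otimes>\<^bsub>B\<^esub> u e \<ominus>\<^bsub>B\<^esub> n e \<in> ?T e" for e
      using m mem_Idl_sequence_ring_iff[OF B tk P.minus_closed[OF P.m_closed[OF yk u] nc]]
      unfolding sequence_ring_minus[OF B P.m_closed[OF yk u] nc] by simp
    have "\<exists>c. c \<in> carrier B \<and> (l < e \<longrightarrow> c \<in> ?I e (e - Suc l)) \<and> u e \<ominus>\<^bsub>B\<^esub> c \<in> ?T e" for e
    proof (cases "l < e")
      case True
      then have "Suc (e - Suc l) = e - l" by simp
      then have "\<exists>c \<in> ?I e (e - Suc l). u e \<ominus>\<^bsub>B\<^esub> c \<in> ?T e"
        using B.regular_sequence_approximate[OF reg[of e], of k "u e" "n e" "e - Suc l"]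
          k uB n me[of e] True by (simp add: take_map)
      then show ?thesis using ideal.Icarr[OF B.genideal_ideal[OF IB]] True by blast
    next
      case False
      have "u e \<ominus>\<^bsub>B\<^esub> u e \<in> ?T e"
        using uB additive_subgroup.zero_closed[OF ideal.axioms(1)[OF T]] by (simp add: B.minus_eq B.r_neg)
      then show ?thesis using uB False by blast
    qed
    then obtain c where c: "\<And>e. c e \<in> carrier B" "\<And>e. l < e \<Longrightarrow> c e \<in> ?I e (e - Suc l)"
      "\<And>e. u e \<ominus>\<^bsub>B\<^esub> c e \<in> ?T e"
      by metis
    have cc: "c \<in> carrier (sequence_ring B)" using c(1) by simp
    have "c \<in> null_sequences B ys"
      using cc c(2) unfolding null_sequences_def by (auto intro!: exI[of _ "Suc l"])
    moreover have "u \<ominus>\<^bsub>sequence_ring B\<^esub> c \<in> Idl\<^bsub>sequence_ring B\<^esub> (set (take k ys))"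
      using c(3) mem_Idl_sequence_ring_iff[OF B tk P.minus_closed[OF u cc]]
      unfolding sequence_ring_minus[OF B u cc] by simp
    ultimately show "\<exists>n' \<in> null_sequences B ys. u \<ominus>\<^bsub>sequence_ring B\<^esub> n'
        \<in> Idl\<^bsub>sequence_ring B\<^esub> (set (take k ys))" by blast
  next
    show "\<one>\<^bsub>sequence_ring B\<^esub> \<ominus>\<^bsub>sequence_ring B\<^esub> n \<notin> Idl\<^bsub>sequence_ring B\<^esub> (set ys)"
    proof
      \<comment> \<open>the first entry where the error lies in the ideal generated by the sequence itself\<close>
      let ?e = "Suc l"
      assume "\<one>\<^bsub>sequence_ring B\<^esub> \<ominus>\<^bsub>sequence_ring B\<^esub> n \<in> Idl\<^bsub>sequence_ring B\<^esub> (set ys)"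
      then have 1: "\<one>\<^bsub>B\<^esub> \<ominus>\<^bsub>B\<^esub> n ?e \<in> Idl\<^bsub>B\<^esub> ((\<lambda>y. y ?e) ` set ys)"
        using mem_Idl_sequence_ring_iff[OF B ys P.minus_closed[OF P.one_closed nc]]
        unfolding sequence_ring_minus[OF B P.one_closed nc] by simp
      interpret J: ideal "Idl\<^bsub>B\<^esub> ((\<lambda>y. y ?e) ` set ys)" B by (rule B.genideal_ideal[OF ysB])
      have "?e - l = 1" by simp
      then have "n ?e \<in> ?I ?e 1" using n le_SucI[OF order_refl] by metis
      moreover have "?I ?e 1 \<subseteq> Idl\<^bsub>B\<^esub> ((\<lambda>y. y ?e) ` set ys)"
      proof (intro B.Idl_mono ysB image_subsetI)
        fix x assume "x \<in> (\<lambda>y. y ?e) ` set ys"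
        then have "x \<in> Idl\<^bsub>B\<^esub> ((\<lambda>y. y ?e) ` set ys)" using B.genideal_self[OF ysB] by blast
        then show "x [^]\<^bsub>B\<^esub> (1::nat) \<in> Idl\<^bsub>B\<^esub> ((\<lambda>y. y ?e) ` set ys)"
          by (rule B.power_mem_Idl[OF _ ysB]) simp
      qed
      ultimately have "(\<one>\<^bsub>B\<^esub> \<ominus>\<^bsub>B\<^esub> n ?e) \<oplus>\<^bsub>B\<^esub> n ?e \<in> Idl\<^bsub>B\<^esub> ((\<lambda>y. y ?e) ` set ys)"
        using 1 by (intro J.a_closed) auto
      moreover have "(\<one>\<^bsub>B\<^esub> \<ominus>\<^bsub>B\<^esub> n ?e) \<oplus>\<^bsub>B\<^esub> n ?e = \<one>\<^bsub>B\<^esub>"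
        using nB[of ?e] B.one_closed by algebra
      ultimately show False using reg[of ?e] by (simp add: B.regular_sequence_iff)
    qed
  }
qed

section \<open>The Frobenius endomorphism\<close>

lemma (in cring) binomial_theorem:
  assumes a: "a \<in> carrier R" and b: "b \<in> carrier R"
  shows "(a \<oplus> b) [^] n = (\<Oplus>k \<in> {..n}. [(n choose k)] \<cdot> (a [^] k \<otimes> b [^] (n - k)))"
proof (induction n)
  case 0
  then show ?case using a b by simp
next
  case (Suc n)
  let ?t = "\<lambda>k. a [^] Suc k \<otimes> b [^] (n - k)"
  have t: "?t k \<in> carrier R" for k using a b by simp
  define s where "s = (\<Oplus>k \<in> {..n}. [(n choose k)] \<cdot> (a [^] k \<otimes> b [^] (n - k)))"
  have s: "s \<in> carrier R" unfolding s_def using a b by (intro finsum_closed) auto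
  have "(a \<oplus> b) [^] Suc n = s \<otimes> (a \<oplus> b)" using Suc.IH by (simp add: s_def)
  also have "\<dots> = a \<otimes> s \<oplus> b \<otimes> s" using a b s by algebra
  also have "a \<otimes> s = (\<Oplus>k \<in> {..n}. [(n choose k)] \<cdot> ?t k)"
    unfolding s_def using a b by (subst finsum_rdistr)
      (auto intro!: finsum_cong' simp: add_pow_rdistr m_ac)
  also have "b \<otimes> s = (\<Oplus>k \<in> {..n}. [(n choose k)] \<cdot> (a [^] k \<otimes> b [^] (Suc n - k)))"
    unfolding s_def using a b by (subst finsum_rdistr)
      (auto intro!: finsum_cong' simp: add_pow_rdistr m_ac Suc_diff_le)
  also have "\<dots> = (\<Oplus>k \<in> {..Suc n}. [(n choose k)] \<cdot> (a [^] k \<otimes> b [^] (Suc n - k)))"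
    using a b by (subst finsum_Suc) (auto simp: binomial_eq_0)
  also have "\<dots> = (\<Oplus>k \<in> {..n}. [(n choose Suc k)] \<cdot> ?t k) \<oplus> b [^] Suc n"
    using a b by (subst finsum_Suc2) auto
  also have "(\<Oplus>k \<in> {..n}. [(n choose k)] \<cdot> ?t k) \<oplus>
      ((\<Oplus>k \<in> {..n}. [(n choose Suc k)] \<cdot> ?t k) \<oplus> b [^] Suc n)
      = (\<Oplus>k \<in> {..n}. [(n choose k)] \<cdot> ?t k \<oplus> [(n choose Suc k)] \<cdot> ?t k) \<oplus> b [^] Suc n"
    using t b by (subst finsum_addf) (auto simp: a_assoc Pi_def)
  also have "\<dots> = (\<Oplus>k \<in> {..n}. [(Suc n choose Suc k)] \<cdot> ?t k) \<oplus> b [^] Suc n"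
    using t by (simp add: add.nat_pow_mult)
  also have "\<dots> = (\<Oplus>k \<in> {..Suc n}. [(Suc n choose k)] \<cdot> (a [^] k \<otimes> b [^] (Suc n - k)))"
    using a b by (subst finsum_Suc2) auto
  finally show ?case .
qed

lemma (in cring) frobenius_add:
  fixes p :: nat
  assumes p: "Factorial_Ring.prime p" and char: "[p] \<cdot> \<one> = \<zero>"
    and a: "a \<in> carrier R" and b: "b \<in> carrier R"
  shows "(a \<oplus> b) [^] p = a [^] p \<oplus> b [^] p"
proof -
  have kill: "[m] \<cdot> x = \<zero>" if "p dvd m" "x \<in> carrier R" for m x
  proof -
    obtain c where c: "m = p * c" using \<open>p dvd m\<close> by blast
    have "[p] \<cdot> x = ([p] \<cdot> \<one>) \<otimes> x" using that by (simp add: add_pow_ldistr)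
    then have "[p] \<cdot> x = \<zero>" using char that by simp
    then show ?thesis using that c add.nat_pow_pow[of x c p] by simp
  qed
  let ?f = "\<lambda>k. [(p choose k)] \<cdot> (a [^] k \<otimes> b [^] (p - k))"
  have f: "?f k \<in> carrier R" for k using a b by simp
  obtain q where q: "p = Suc (Suc q)"
    using prime_ge_2_nat[OF p] by (metis Suc_1 add_2_eq_Suc le_Suc_ex)
  have mid: "(\<Oplus>i \<in> {..q}. ?f (Suc i)) = \<zero>"
  proof -
    have "?f (Suc i) = \<zero>" if "i \<in> {..q}" for i
      using that a b q by (intro kill dvd_choose_prime p) auto
    then have "(\<Oplus>i \<in> {..q}. ?f (Suc i)) = (\<Oplus>i \<in> {..q}. \<zero>)" by (intro finsum_cong') auto
    then show ?thesis by simp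
  qed
  have "(a \<oplus> b) [^] p = (\<Oplus>k \<in> {..Suc (Suc q)}. ?f k)"
    using binomial_theorem[OF a b, of p] q by simp
  also have "\<dots> = ?f (Suc (Suc q)) \<oplus> ((\<Oplus>i \<in> {..q}. ?f (Suc i)) \<oplus> ?f 0)"
    using f by (subst finsum_Suc, simp, subst finsum_Suc2) auto
  also have "\<dots> = a [^] p \<oplus> b [^] p" using mid a b q by simp
  finally show ?thesis .
qed

lemma (in cring) frobenius_power_hom:
  fixes p :: nat
  assumes "Factorial_Ring.prime p" "[p] \<cdot> \<one> = \<zero>"
  shows "(\<lambda>x. x [^] (p ^ e)) \<in> ring_hom R R"
proof (rule ring_hom_memI)
  fix x y assume c: "x \<in> carrier R" "y \<in> carrier R"
  show "(x \<otimes> y) [^] (p ^ e) = x [^] (p ^ e) \<otimes> y [^] (p ^ e)"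
    using c by (rule nat_pow_distrib)
  show "(x \<oplus> y) [^] (p ^ e) = x [^] (p ^ e) \<oplus> y [^] (p ^ e)"
  proof (induction e)
    case (Suc e)
    have "(x \<oplus> y) [^] (p ^ Suc e) = ((x \<oplus> y) [^] (p ^ e)) [^] p"
      using c by (simp add: nat_pow_pow mult.commute)
    also have "\<dots> = (x [^] (p ^ e)) [^] p \<oplus> (y [^] (p ^ e)) [^] p"
      unfolding Suc using c by (intro frobenius_add assms) auto
    finally show ?case using c by (simp add: nat_pow_pow mult.commute)
  qed (use c in simp)
qed auto

lemma ring_hom_add_pow_one:
  assumes "ring_hom_cring R B \<psi>"
  shows "\<psi> ([(n::nat)] \<cdot>\<^bsub>R\<^esub> \<one>\<^bsub>R\<^esub>) = [n] \<cdot>\<^bsub>B\<^esub> \<one>\<^bsub>B\<^esub>"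
proof -
  interpret ring_hom_cring R B \<psi> by fact
  show ?thesis by (induction n) (simp_all add: R.add.nat_pow_Suc S.add.nat_pow_Suc)
qed

lemma ring_char_add_pow_one:
  assumes "cring R"
  shows "[ring_char R] \<cdot>\<^bsub>R\<^esub> \<one>\<^bsub>R\<^esub> = \<zero>\<^bsub>R\<^esub>"
proof -
  interpret cring R by fact
  show ?thesis using add.pow_ord_eq_1[of "\<one>\<^bsub>R\<^esub>"] by (simp add: ring_char_def add_pow_def)
qed

section \<open>Minimal seeds\<close>

lemma algebra_hom_comp:
  assumes "h \<in> algebra_hom R S \<phi> B \<psi>" "g \<in> ring_hom B C"
  shows "g \<circ> h \<in> algebra_hom R S \<phi> C (g \<circ> \<psi>)"
  using assms ring_hom_trans[of h S B g C] by (auto simp: algebra_hom_def)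

lemma big_CM_algebra_comp:
  assumes "ring_hom_cring R B \<psi>" "g \<in> ring_hom B C" "cring C"
    and "system_of_parameters R xs" "regular_sequence C (map g (map \<psi> xs))"
  shows "big_CM_algebra R C (g \<circ> \<psi>)"
proof -
  interpret ring_hom_cring R B \<psi> by fact
  have "ring_hom_cring R C (g \<circ> \<psi>)"
    by (intro ring_hom_cring.intro ring_hom_cring_axioms.intro R.is_cring assms(3)
        ring_hom_trans[OF homh assms(2)])
  then show ?thesis unfolding big_CM_algebra_def using assms(4,5) by (auto intro!: exI[of _ xs])
qed

text \<open>
  If the kernel of \<open>f\<close> were nonzero, then \<open>S\<close> modulo that kernel, which still maps to \<open>B\<close>, would be a
  seed and a proper homomorphic image of \<open>S\<close>.
\<close>
lemma minimal_seed_hom_injective: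
  assumes min: "minimal_seed R S \<phi>" and B: "big_CM_algebra R B \<psi>"
    and f: "f \<in> algebra_hom R S \<phi> B \<psi>"
    and c: "c \<in> carrier S" "f c = \<zero>\<^bsub>B\<^esub>"
  shows "c = \<zero>\<^bsub>S\<^esub>"
proof (rule ccontr)
  assume nz: "c \<noteq> \<zero>\<^bsub>S\<^esub>"
  interpret \<phi>: ring_hom_cring R S \<phi> using min by (auto simp: minimal_seed_def seed_def)
  interpret \<psi>: ring_hom_cring R B \<psi> using B by (auto simp: big_CM_algebra_def)
  have fh: "f \<in> ring_hom S B" "\<And>r. r \<in> carrier R \<Longrightarrow> f (\<phi> r) = \<psi> r"
    using f by (auto simp: algebra_hom_def)
  interpret f: ring_hom_ring S B f
    by (rule ring_hom_ringI2[OF \<phi>.S.ring_axioms \<psi>.S.ring_axioms fh(1)])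
  let ?J = "a_kernel S B f"
  interpret J: ideal ?J S by (rule f.kernel_is_ideal)
  let ?g = "\<lambda>A. the_elem (f ` A)"
  have "c \<in> ?J" using c unfolding a_kernel_def' by blast
  then have "?J \<noteq> {\<zero>\<^bsub>S\<^esub>}" using nz by blast
  then have "\<not> seed R (S Quot ?J) (\<lambda>r. ?J +>\<^bsub>S\<^esub> \<phi> r)"
    using min J.ideal_axioms by (auto simp: minimal_seed_def)
  moreover have "seed R (S Quot ?J) (\<lambda>r. ?J +>\<^bsub>S\<^esub> \<phi> r)"
  proof (rule seed_if_hom_to_big_CM[OF _ B])
    have "(\<lambda>r. ?J +>\<^bsub>S\<^esub> \<phi> r) \<in> ring_hom R (S Quot ?J)"
      using ring_hom_trans[OF \<phi>.homh J.rcos_ring_hom] by (simp add: comp_def)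
    then show "ring_hom_cring R (S Quot ?J) (\<lambda>r. ?J +>\<^bsub>S\<^esub> \<phi> r)"
      by (intro ring_hom_cring.intro ring_hom_cring_axioms.intro \<phi>.R.is_cring
          J.quotient_is_cring \<phi>.S.is_cring)
    show "?g \<in> algebra_hom R (S Quot ?J) (\<lambda>r. ?J +>\<^bsub>S\<^esub> \<phi> r) B \<psi>"
      using f.the_elem_hom fh(2) by (simp add: algebra_hom_def)
  qed
  ultimately show False by blast
qed

theorem proposition7p2:
  fixes R :: "('r, 'm) ring_scheme" and S :: "('s, 'n) ring_scheme"
    and \<phi> :: "'r \<Rightarrow> 's" and p :: nat
  assumes "noetherian_local_ring R"
    and "Factorial_Ring.prime p" and "ring_char R = p"
    and "minimal_seed R S \<phi>"
  shows "domain S"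
proof -
  obtain B :: "('s + nat) list ring" and \<psi> h where B: "big_CM_algebra R B \<psi>"
    and h: "h \<in> algebra_hom R S \<phi> B \<psi>" and "ring_hom_cring R S \<phi>"
    using assms(4) by (auto simp: minimal_seed_def seed_def)
  then interpret \<phi>: ring_hom_cring R S \<phi> by simp
  have \<psi>: "ring_hom_cring R B \<psi>" using B by (auto simp: big_CM_algebra_def)
  then interpret \<psi>: ring_hom_cring R B \<psi> .
  obtain xs where xs: "system_of_parameters R xs" and reg: "regular_sequence B (map \<psi> xs)"
    using B by (auto simp: big_CM_algebra_def)
  let ?X = "\<psi> ` set xs"
  have XB: "?X \<subseteq> carrier B" using reg by (simp add: regular_sequence_def)
  have hS: "h \<in> ring_hom S B" using h by (simp add: algebra_hom_def)
  interpret h: ring_hom_ring S B h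
    by (rule ring_hom_ringI2[OF \<phi>.S.ring_axioms \<psi>.S.ring_axioms hS])
  have char: "[p] \<cdot>\<^bsub>B\<^esub> \<one>\<^bsub>B\<^esub> = \<zero>\<^bsub>B\<^esub>"
    using ring_hom_add_pow_one[OF \<psi>, of p] ring_char_add_pow_one[OF \<phi>.R.is_cring] assms(3)
    by simp
  have p: "p ^ e > e" "p ^ e > 0" for e
    using prime_gt_1_nat[OF assms(2)] by (auto simp: power_gt_expt)
  let ?P = "sequence_ring B"
  have P: "cring ?P" by (rule cring_sequence_ring[OF \<psi>.S.is_cring])
  interpret P: cring ?P by (rule P)
  define \<Delta> where "\<Delta> = (\<lambda>x e. x [^]\<^bsub>B\<^esub> (p ^ e))"
  have \<Delta>: "\<Delta> \<in> ring_hom B ?P"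
    using \<psi>.S.frobenius_power_hom[OF assms(2) char] by (auto simp: ring_hom_def \<Delta>_def)
  define ys where "ys = map \<Delta> (map \<psi> xs)"
  have ys: "set ys \<subseteq> carrier ?P"
    using XB ring_hom_closed[OF \<Delta>] by (auto simp: ys_def)
  have set_ys: "(\<lambda>y. y e) ` set ys = (\<lambda>x. x [^]\<^bsub>B\<^esub> (p ^ e)) ` ?X" for e
    by (auto simp: ys_def \<Delta>_def)
  have reg_ys: "regular_sequence B (map (\<lambda>y. y e) ys)" for e
    using \<psi>.S.regular_sequence_powers[OF reg p(2)[of e]] by (simp add: ys_def \<Delta>_def comp_def)
  have kills: "c = \<zero>\<^bsub>S\<^esub>" if C: "cring C" and \<pi>: "\<pi> \<in> ring_hom ?P C"
    and regC: "regular_sequence C (map \<pi> ys)"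
    and c: "c \<in> carrier S" "\<pi> (\<Delta> (h c)) = \<zero>\<^bsub>C\<^esub>"
    for C :: "'d ring" and \<pi> c
  proof (rule minimal_seed_hom_injective[OF assms(4)])
    have g: "\<pi> \<circ> \<Delta> \<in> ring_hom B C" by (rule ring_hom_trans[OF \<Delta> \<pi>])
    show "big_CM_algebra R C ((\<pi> \<circ> \<Delta>) \<circ> \<psi>)"
      using regC by (intro big_CM_algebra_comp[OF \<psi> g C xs]) (simp add: ys_def comp_assoc)
    show "(\<pi> \<circ> \<Delta>) \<circ> h \<in> algebra_hom R S \<phi> C ((\<pi> \<circ> \<Delta>) \<circ> \<psi>)" by (rule algebra_hom_comp[OF h g])
    show "c \<in> carrier S" "((\<pi> \<circ> \<Delta>) \<circ> h) c = \<zero>\<^bsub>C\<^esub>" using c by simp_all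
  qed
  show ?thesis
  proof (intro domain.intro domain_axioms.intro \<phi>.S.is_cring)
    show "\<one>\<^bsub>S\<^esub> \<noteq> \<zero>\<^bsub>S\<^esub>"
    proof
      assume "\<one>\<^bsub>S\<^esub> = \<zero>\<^bsub>S\<^esub>"
      then have "\<one>\<^bsub>B\<^esub> = \<zero>\<^bsub>B\<^esub>" using h.hom_one h.hom_zero by simp
      then have "\<one>\<^bsub>B\<^esub> \<in> Idl\<^bsub>B\<^esub> ?X"
        using additive_subgroup.zero_closed[OF ideal.axioms(1)[OF \<psi>.S.genideal_ideal[OF XB]]]
        by simp
      then show False using reg by (simp add: \<psi>.S.regular_sequence_iff)
    qed
  next
    fix a b assume ab: "a \<otimes>\<^bsub>S\<^esub> b = \<zero>\<^bsub>S\<^esub>" and a: "a \<in> carrier S" and b: "b \<in> carrier S"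
    have ha: "h a \<in> carrier B" and hb: "h b \<in> carrier B" using a b by simp_all
    have hab: "h a \<otimes>\<^bsub>B\<^esub> h b = \<zero>\<^bsub>B\<^esub>" using ab a b h.hom_mult[of a b] by simp
    show "a = \<zero>\<^bsub>S\<^esub> \<or> b = \<zero>\<^bsub>S\<^esub>"
    proof (cases "\<exists>k::nat. \<forall>e. h a [^]\<^bsub>B\<^esub> k \<in> Idl\<^bsub>B\<^esub> ((\<lambda>x. x [^]\<^bsub>B\<^esub> (p ^ e)) ` ?X)")
      case True
      then obtain k :: nat where k: "\<And>e. h a [^]\<^bsub>B\<^esub> k \<in> Idl\<^bsub>B\<^esub> ((\<lambda>x. x [^]\<^bsub>B\<^esub> (p ^ e)) ` ?X)"
        by blast
      let ?N = "null_sequences B ys"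
      have N: "ideal ?N ?P" by (rule ideal_null_sequences[OF \<psi>.S.is_cring ys])
      interpret N: ideal ?N ?P by (rule N)
      have "\<Delta> (h a) e \<in> Idl\<^bsub>B\<^esub> ((\<lambda>x. x [^]\<^bsub>B\<^esub> (e - k)) ` (\<lambda>y. y e) ` set ys)" if "k \<le> e" for e
      proof -
        \<comment> \<open>the generators at entry \<open>e\<close> are \<open>p ^ e\<close>-th powers of the parameters already; the ideals for
          the exponents \<open>p ^ n\<close> form a cofinal family, and \<open>?m \<le> p ^ ?m\<close>\<close>
        let ?m = "p ^ e * (e - k)"
        have "(\<lambda>x. x [^]\<^bsub>B\<^esub> ?m) ` ?X = (\<lambda>x. x [^]\<^bsub>B\<^esub> (e - k)) ` (\<lambda>y. y e) ` set ys"
          unfolding set_ys image_image using XB by (intro image_cong refl) (auto simp: \<psi>.S.nat_pow_pow)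
        moreover have m: "(\<lambda>x. x [^]\<^bsub>B\<^esub> ?m) ` ?X \<subseteq> carrier B" using XB by auto
        moreover have "h a [^]\<^bsub>B\<^esub> k \<in> Idl\<^bsub>B\<^esub> ((\<lambda>x. x [^]\<^bsub>B\<^esub> ?m) ` ?X)"
          using k[of ?m] \<psi>.S.Idl_powers_antimono[OF XB, of ?m "p ^ ?m"] p(1)[of ?m] by auto
        then have "h a [^]\<^bsub>B\<^esub> (p ^ e - k) \<otimes>\<^bsub>B\<^esub> h a [^]\<^bsub>B\<^esub> k \<in> Idl\<^bsub>B\<^esub> ((\<lambda>x. x [^]\<^bsub>B\<^esub> ?m) ` ?X)"
          using ha by (intro ideal.I_l_closed[OF \<psi>.S.genideal_ideal[OF m]]) auto
        moreover have "h a [^]\<^bsub>B\<^esub> (p ^ e - k) \<otimes>\<^bsub>B\<^esub> h a [^]\<^bsub>B\<^esub> k = h a [^]\<^bsub>B\<^esub> (p ^ e)"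
          using ha that p(1)[of e] by (simp add: \<psi>.S.nat_pow_mult)
        ultimately show ?thesis by (simp add: \<Delta>_def)
      qed
      then have "\<Delta> (h a) \<in> ?N"
        using ring_hom_closed[OF \<Delta> ha] by (auto simp: null_sequences_def)
      then have "?N +>\<^bsub>?P\<^esub> \<Delta> (h a) = \<zero>\<^bsub>?P Quot ?N\<^esub>"
        using N.a_rcos_const by (simp add: FactRing_def)
      then have "a = \<zero>\<^bsub>S\<^esub>"
        using kills[OF N.quotient_is_cring[OF P] N.rcos_ring_hom _ a]
          regular_sequence_Quot_null_sequences[OF \<psi>.S.is_cring ys reg_ys] by simp
      then show ?thesis ..
    next
      case False
      define \<alpha> where "\<alpha> = (\<lambda>e::nat. h a)"
      define W where "W = range (\<lambda>k::nat. \<alpha> [^]\<^bsub>?P\<^esub> k)"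
      have \<alpha>: "\<alpha> \<in> carrier ?P" using ha by (simp add: \<alpha>_def)
      interpret W: multiplicative_subset ?P W
      proof
        show "W \<subseteq> carrier ?P" using P.nat_pow_closed[OF \<alpha>] by (auto simp: W_def)
        have "\<one>\<^bsub>?P\<^esub> = \<alpha> [^]\<^bsub>?P\<^esub> (0::nat)" by simp
        then show "\<one>\<^bsub>?P\<^esub> \<in> W" unfolding W_def by blast
        show "s \<otimes>\<^bsub>?P\<^esub> t \<in> W" if st: "s \<in> W" "t \<in> W" for s t
        proof -
          obtain i j :: nat where "s = \<alpha> [^]\<^bsub>?P\<^esub> i" "t = \<alpha> [^]\<^bsub>?P\<^esub> j"
            using st unfolding W_def by blast
          then have "s \<otimes>\<^bsub>?P\<^esub> t = \<alpha> [^]\<^bsub>?P\<^esub> (i + j)" using P.nat_pow_mult[OF \<alpha>] by simp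
          then show ?thesis unfolding W_def by blast
        qed
      qed
      have "W \<inter> Idl\<^bsub>?P\<^esub> (set ys) = {}"
      proof (rule ccontr)
        assume "W \<inter> Idl\<^bsub>?P\<^esub> (set ys) \<noteq> {}"
        then obtain k :: nat where "\<alpha> [^]\<^bsub>?P\<^esub> k \<in> Idl\<^bsub>?P\<^esub> (set ys)" by (auto simp: W_def)
        then have "\<forall>e. h a [^]\<^bsub>B\<^esub> k \<in> Idl\<^bsub>B\<^esub> ((\<lambda>y. y e) ` set ys)"
          using mem_Idl_sequence_ring_iff[OF \<psi>.S.is_cring ys P.nat_pow_closed[OF \<alpha>], of k]
          unfolding sequence_ring_pow \<alpha>_def by simp
        then show False using False unfolding set_ys by blast
      qed
      then have regW: "regular_sequence W.fraction_ring (map (\<lambda>u. W.fraction u \<one>\<^bsub>?P\<^esub>) ys)"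
        using regular_sequence_sequence_ring[OF \<psi>.S.is_cring ys reg_ys]
        by (intro W.regular_sequence_fraction_ring)
      have hom: "(\<lambda>u. W.fraction u \<one>\<^bsub>?P\<^esub>) \<in> ring_hom ?P W.fraction_ring"
        by (rule ring_hom_cring.homh[OF W.ring_hom_fraction_ring])
      have "h a \<otimes>\<^bsub>B\<^esub> h b [^]\<^bsub>B\<^esub> (p ^ e) = \<zero>\<^bsub>B\<^esub>" for e
      proof -
        obtain m where "p ^ e = Suc m" using p(2)[of e] gr0_implies_Suc by blast
        then have "h a \<otimes>\<^bsub>B\<^esub> h b [^]\<^bsub>B\<^esub> (p ^ e) = (h a \<otimes>\<^bsub>B\<^esub> h b) \<otimes>\<^bsub>B\<^esub> h b [^]\<^bsub>B\<^esub> m"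
          using ha hb by (simp add: \<psi>.S.m_ac)
        then show ?thesis using hab hb by simp
      qed
      then have "\<alpha> \<otimes>\<^bsub>?P\<^esub> \<Delta> (h b) = \<zero>\<^bsub>?P\<^esub>" by (simp add: \<alpha>_def \<Delta>_def)
      moreover have "\<alpha> [^]\<^bsub>?P\<^esub> (1::nat) \<in> W" unfolding W_def by blast
      then have "\<alpha> \<in> W" using \<alpha> by (metis P.nat_pow_eone)
      ultimately have "W.fraction (\<Delta> (h b)) \<one>\<^bsub>?P\<^esub> = \<zero>\<^bsub>W.fraction_ring\<^esub>"
        unfolding W.fraction_ring_zero using ring_hom_closed[OF \<Delta> hb] W.W_one \<alpha>
        by (intro W.fraction_eqI[where w = \<alpha>])
          (simp_all del: sequence_ring_simps add: P.l_one P.r_null)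
      then have "b = \<zero>\<^bsub>S\<^esub>"
        by (rule kills[OF W.cring_fraction_ring hom regW b])
      then show ?thesis ..
    qed
  qed
qed

end
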